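(* Let $X\subset\mathbb{P}^5_{\mathbb{Q}}$ be the complete intersection of three quadrics given in affine coordinates $(x,y,u,v,w)$ by $$x+y=u^2,\qquad xy+x+y=v^2,\qquad xy-x-y=w^2.$$ Then $X$ is a rational surface over $\mathbb{Q}$. More precisely, the formulas $$x=\lambda^2+a^2+\frac{1}{4a^2},\quad y=\left(a^2+\frac{1}{4a^2}\right)\frac{x}{\lambda^2},\quad u=\frac{x}{\lambda},\quad v=\left(a+\frac{1}{2a}\right)\frac{x}{\lambda},\quad w=\left(a-\frac{1}{2a}\right)\frac{x}{\lambda}$$ in the parameters $(a,\lambda)$ define a birational map $\mathbb{P}^2\dashrightarrow X$ over $\mathbb{Q}$.
   Context: In homogeneous coordinates $(x:y:u:v:w:z)$ on $\mathbb{P}^5$, the surface $X$ is given by $(x+y)z=u^2$, $xy+(x+y)z=v^2$, $xy-(x+y)z=w^2$. Here $(a,\lambda)$ are affine coordinates on $\mathbb{P}^2$. A rational surface over $\mathbb{Q}$ means a surface birationally equivalent to $\mathbb{P}^2$ over $\mathbb{Q}$. *)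

theory Defs
  imports
    "HOL-Library.Poly_Mapping"
    "HOL-Library.Extended_Nat"
    "HOL-Library.Cardinality"
    "HOL-Algebra.Algebraic_Closure_Type"
begin

text \<open>
  Conventions. A projective variety over \<open>\<rat>\<close> is given by its set of geometric points, as in
  Silverman or Shafarevich: \<open>'k\<close> is to be an algebraic closure of \<open>\<rat>\<close>, and ``over \<open>\<rat>\<close>''
  means that all polynomials involved have coefficients in \<open>\<rat> \<subseteq> 'k\<close>. The homogeneous coordinates
  on a projective space are indexed by a finite type \<open>'n\<close>, so that its dimension is \<open>CARD('n) - 1\<close>.
  A set of projective points is represented by the set of all of its nonzero coordinate vectors.
\<close>

subsection \<open>Polynomials\<close>

type_synonym ('n, 'k) mpoly = "('n \<Rightarrow>\<^sub>0 nat) \<Rightarrow>\<^sub>0 'k"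

definition var :: "'n \<Rightarrow> ('n, 'k::field_char_0) mpoly" where
  "var i = Poly_Mapping.single (Poly_Mapping.single i 1) 1"

definition eval :: "('n::finite, 'k::field_char_0) mpoly \<Rightarrow> ('n \<Rightarrow> 'k) \<Rightarrow> 'k" where
  "eval f p = (\<Sum>m\<in>Poly_Mapping.keys f.
     Poly_Mapping.lookup f m * (\<Prod>i\<in>UNIV. p i ^ Poly_Mapping.lookup m i))"

definition homogeneous :: "nat \<Rightarrow> ('n::finite, 'k::field_char_0) mpoly \<Rightarrow> bool" where
  "homogeneous d f \<longleftrightarrow>
     (\<forall>m\<in>Poly_Mapping.keys f. (\<Sum>i\<in>UNIV. Poly_Mapping.lookup m i) = d)"

definition rational_coeffs :: "('n, 'k::field_char_0) mpoly \<Rightarrow> bool" where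
  "rational_coeffs f \<longleftrightarrow> (\<forall>m. Poly_Mapping.lookup f m \<in> \<rat>)"

subsection \<open>Projective space and its closed subsets\<close>

definition proj_space :: "('n::finite \<Rightarrow> 'k::field_char_0) set" where
  "proj_space = {p. p \<noteq> (\<lambda>_. 0)}"

definition proj_eq :: "('n \<Rightarrow> 'k::field_char_0) \<Rightarrow> ('n \<Rightarrow> 'k) \<Rightarrow> bool" (infix "\<simeq>" 50) where
  "p \<simeq> q \<longleftrightarrow> p \<noteq> (\<lambda>_. 0) \<and> (\<exists>c. c \<noteq> 0 \<and> q = (\<lambda>i. c * p i))"

definition zero_locus :: "('n::finite, 'k::field_char_0) mpoly set \<Rightarrow> ('n \<Rightarrow> 'k) set" where
  "zero_locus S = {p \<in> proj_space. \<forall>f\<in>S. eval f p = 0}"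

definition zariski_closed :: "('n::finite \<Rightarrow> 'k::field_char_0) set \<Rightarrow> bool" where
  "zariski_closed V \<longleftrightarrow> (\<exists>S. (\<forall>f\<in>S. \<exists>d. homogeneous d f) \<and> V = zero_locus S)"

definition irreducible_closed :: "('n::finite \<Rightarrow> 'k::field_char_0) set \<Rightarrow> bool" where
  "irreducible_closed V \<longleftrightarrow> zariski_closed V \<and> V \<noteq> {} \<and>
     (\<forall>A B. zariski_closed A \<and> zariski_closed B \<and> V = A \<union> B \<longrightarrow> V = A \<or> V = B)"

text \<open>Krull dimension of a closed set. (The value on the empty set is \<open>0\<close>.)\<close>

definition proj_dim :: "('n::finite \<Rightarrow> 'k::field_char_0) set \<Rightarrow> enat" where
  "proj_dim V = (SUP n \<in> {n. \<exists>Z :: nat \<Rightarrow> ('n \<Rightarrow> 'k) set.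
     (\<forall>i\<le>n. irreducible_closed (Z i) \<and> Z i \<subseteq> V) \<and> (\<forall>i<n. Z i \<subset> Z (Suc i))}. enat n)"

text \<open>Irreducibility is with respect to all closed subsets of the space of geometric points,
  so these varieties are geometrically irreducible.\<close>

definition variety_over_Q :: "('n::finite \<Rightarrow> 'k::field_char_0) set \<Rightarrow> bool" where
  "variety_over_Q V \<longleftrightarrow> irreducible_closed V \<and>
     (\<exists>S. (\<forall>f\<in>S. rational_coeffs f \<and> (\<exists>d. homogeneous d f)) \<and> V = zero_locus S)"

text \<open>Complete intersection in the ideal-theoretic sense: the forms in \<open>Q\<close> generate the whole
  vanishing ideal of \<open>V\<close>, and there are as many of them as the codimension of \<open>V\<close>. In particular
  the scheme defined by \<open>Q\<close> is reduced and is faithfully described by its geometric points.\<close>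

definition vanishing_ideal ::
  "('n::finite \<Rightarrow> 'k::field_char_0) set \<Rightarrow> ('n, 'k) mpoly set" where
  "vanishing_ideal V = {f. \<forall>p\<in>V. eval f p = 0}"

definition complete_intersection_over_Q ::
  "('n::finite \<Rightarrow> 'k::field_char_0) set \<Rightarrow> ('n, 'k) mpoly set \<Rightarrow> bool" where
  "complete_intersection_over_Q V Q \<longleftrightarrow>
     finite Q \<and> (\<forall>f\<in>Q. rational_coeffs f \<and> (\<exists>d. homogeneous d f)) \<and>
     V = zero_locus Q \<and>
     vanishing_ideal V = {f. \<exists>c. f = (\<Sum>q\<in>Q. c q * q)} \<and>
     proj_dim V + enat (card Q) + 1 = enat CARD('n)"

subsection \<open>Rational and birational maps\<close>

definition eval_map ::
  "('m \<Rightarrow> ('n::finite, 'k::field_char_0) mpoly) \<Rightarrow> ('n \<Rightarrow> 'k) \<Rightarrow> ('m \<Rightarrow> 'k)" where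
  "eval_map F p = (\<lambda>j. eval (F j) p)"

text \<open>A rational map between (irreducible) varieties is represented by a tuple of forms of equal
  degree which do not all vanish identically on the source; it is defined at least where
  these forms have no common zero.\<close>

definition rational_map_over_Q ::
  "('n::finite \<Rightarrow> 'k::field_char_0) set \<Rightarrow> ('m::finite \<Rightarrow> 'k) set \<Rightarrow>
   ('m \<Rightarrow> ('n, 'k) mpoly) \<Rightarrow> bool" where
  "rational_map_over_Q V W F \<longleftrightarrow>
     (\<exists>d. \<forall>j. homogeneous d (F j) \<and> rational_coeffs (F j)) \<and>
     (\<exists>p\<in>V. eval_map F p \<noteq> (\<lambda>_. 0)) \<and>
     (\<forall>p\<in>V. eval_map F p \<noteq> (\<lambda>_. 0) \<longrightarrow> eval_map F p \<in> W)"

text \<open>The composite of \<open>F\<close> and \<open>G\<close> is defined on a nonempty open subset of \<open>V\<close> and is the identity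
  there.\<close>

definition left_inverse_map ::
  "('n::finite \<Rightarrow> 'k::field_char_0) set \<Rightarrow> ('m::finite \<Rightarrow> ('n, 'k) mpoly) \<Rightarrow>
   ('n \<Rightarrow> ('m, 'k) mpoly) \<Rightarrow> bool" where
  "left_inverse_map V F G \<longleftrightarrow>
     (\<exists>p\<in>V. eval_map F p \<noteq> (\<lambda>_. 0) \<and> eval_map G (eval_map F p) \<noteq> (\<lambda>_. 0)) \<and>
     (\<forall>p\<in>V. eval_map F p \<noteq> (\<lambda>_. 0) \<and> eval_map G (eval_map F p) \<noteq> (\<lambda>_. 0) \<longrightarrow>
        eval_map G (eval_map F p) \<simeq> p)"

definition birational_map_over_Q ::
  "('n::finite \<Rightarrow> 'k::field_char_0) set \<Rightarrow> ('m::finite \<Rightarrow> 'k) set \<Rightarrow>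
   ('m \<Rightarrow> ('n, 'k) mpoly) \<Rightarrow> bool" where
  "birational_map_over_Q V W F \<longleftrightarrow> rational_map_over_Q V W F \<and>
     (\<exists>G. rational_map_over_Q W V G \<and> left_inverse_map V F G \<and> left_inverse_map W G F)"

subsection \<open>The projective plane and rational surfaces\<close>

datatype coord2 = CA | CL | CT

instance coord2 :: finite
proof
  have "(UNIV :: coord2 set) = {CA, CL, CT}"
    using coord2.exhaust by auto
  then show "finite (UNIV :: coord2 set)" by (metis finite.emptyI finite.insertI)
qed

definition point2 :: "'k \<Rightarrow> 'k \<Rightarrow> 'k \<Rightarrow> coord2 \<Rightarrow> 'k" where
  "point2 a l t = (\<lambda>i. case i of CA \<Rightarrow> a | CL \<Rightarrow> l | CT \<Rightarrow> t)"

definition rational_surface_over_Q :: "('n::finite \<Rightarrow> 'k::field_char_0) set \<Rightarrow> bool" where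
  "rational_surface_over_Q V \<longleftrightarrow> variety_over_Q V \<and> proj_dim V = 2 \<and>
     (\<exists>F. birational_map_over_Q (proj_space :: (coord2 \<Rightarrow> 'k) set) V F)"

subsection \<open>The surface\<close>

datatype coord5 = CX | CY | CU | CV | CW | CZ

instance coord5 :: finite
proof
  have "(UNIV :: coord5 set) = {CX, CY, CU, CV, CW, CZ}"
    using coord5.exhaust by auto
  then show "finite (UNIV :: coord5 set)" by (metis finite.emptyI finite.insertI)
qed

definition point5 :: "'k \<Rightarrow> 'k \<Rightarrow> 'k \<Rightarrow> 'k \<Rightarrow> 'k \<Rightarrow> 'k \<Rightarrow> coord5 \<Rightarrow> 'k" where
  "point5 x y u v w z =
     (\<lambda>i. case i of CX \<Rightarrow> x | CY \<Rightarrow> y | CU \<Rightarrow> u | CV \<Rightarrow> v | CW \<Rightarrow> w | CZ \<Rightarrow> z)"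

definition quadrics :: "(coord5, 'k::field_char_0) mpoly set" where
  "quadrics =
     {(var CX + var CY) * var CZ - var CU ^ 2,
      var CX * var CY + (var CX + var CY) * var CZ - var CV ^ 2,
      var CX * var CY - (var CX + var CY) * var CZ - var CW ^ 2}"

definition surface_X :: "(coord5 \<Rightarrow> 'k::field_char_0) set" where
  "surface_X = zero_locus quadrics"

end

theory Submission
  imports Defs
begin

text \<open>
  Birationality is a direct computation. After homogenization the parametrization is given by forms
  of degree \<open>8\<close> in \<open>(a, l, t)\<close> (\<open>surface_param\<close>), and the forms \<open>(v + w, 2 x, 2 u)\<close> define a map back
  to the plane (\<open>surface_param_inv\<close>). Both composites multiply the coordinate vector by a scalar
  that is a polynomial in its entries (\<open>param_inv_param\<close>, \<open>param_param_inv\<close>), so wherever they are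
  defined they are the identity.

  The vanishing ideal is found by elimination of square roots. Modulo the three quadrics, a
  polynomial is a combination of the eight monomials \<open>u\<^sup>i v\<^sup>j w\<^sup>k\<close> with exponents at most \<open>1\<close> and
  coefficients in \<open>k[x, y, z]\<close>. As \<open>X\<close> is stable under each of the sign changes of \<open>u\<close>, \<open>v\<close>, \<open>w\<close>
  and surjects onto the \<open>(x : y : z)\<close>-plane, such a combination vanishes on \<open>X\<close> only if all its
  coefficients are zero. In fact it is enough that its product with some nonzero polynomial in
  \<open>x, y, z\<close> vanishes on \<open>X\<close> (\<open>torsion_free_surface_X\<close>). With the multiplier \<open>1\<close> this gives the vanishing ideal; with the
  multiplier \<open>x (x + y)\<^sup>2 z\<close>, off whose zeros every point of \<open>X\<close> is in the image, it shows
  that the parametrization is dominant (\<open>surface_param_dense\<close>).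

  A closed set with a dominant polynomial parametrization is irreducible, because two nonzero
  polynomials have a common non-zero. Its dimension is bounded without general dimension theory:
  forms cutting the members of a chain of \<open>n + 1\<close> irreducible closed sets out of each other
  are, together with one coordinate, \<open>n + 1\<close> algebraically independent forms on the largest member
  (\<open>chain_forms_independent\<close>), whereas counting monomials shows that \<open>N + 1\<close> forms always satisfy a
  relation when they are pulled back to \<open>N\<close> variables (\<open>proj_dim_le_parametrized\<close>).
  The chain of a point, a line and the whole of \<open>X\<close> shows that the resulting bound \<open>2\<close> is attained.
\<close>

section \<open>Evaluation, homogeneity and rationality\<close>

text \<open>The polynomial with constant value \<open>c\<close>.\<close>

definition const :: "'k \<Rightarrow> ('n, 'k::field_char_0) mpoly" where
  "const c = Poly_Mapping.single 0 c"

text \<open>The value of the monomial with exponents \<open>m\<close> at the point \<open>p\<close>.\<close>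

definition mono_val :: "('n::finite \<Rightarrow>\<^sub>0 nat) \<Rightarrow> ('n \<Rightarrow> 'k::field_char_0) \<Rightarrow> 'k" where
  "mono_val m p = (\<Prod>i\<in>UNIV. p i ^ Poly_Mapping.lookup m i)"

text \<open>Total degree of the monomial with exponents \<open>m\<close>.\<close>

definition mdeg :: "('n::finite \<Rightarrow>\<^sub>0 nat) \<Rightarrow> nat" where
  "mdeg m = (\<Sum>i\<in>UNIV. Poly_Mapping.lookup m i)"

lemma eval_superset:
  assumes "finite A" "Poly_Mapping.keys f \<subseteq> A"
  shows "eval f p = (\<Sum>m\<in>A. Poly_Mapping.lookup f m * mono_val m p)"
  unfolding eval_def mono_val_def
  using assms by (intro sum.mono_neutral_left) (auto simp: in_keys_iff)

lemma eval_single: "eval (Poly_Mapping.single m c) p = c * mono_val m p"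
  by (subst eval_superset[of "{m}"]) auto

lemma eval_zero [simp]: "eval 0 p = 0"
  by (simp add: eval_def)

lemma eval_add [simp]: "eval (f + g) p = eval f p + eval g p"
proof -
  let ?A = "Poly_Mapping.keys f \<union> Poly_Mapping.keys g"
  show ?thesis
    by (subst (1 2 3) eval_superset[of ?A])
       (use Poly_Mapping.keys_add[of f g] in
         \<open>auto simp: lookup_add algebra_simps sum.distrib\<close>)
qed

lemma eval_sum [simp]: "eval (\<Sum>x\<in>A. f x) p = (\<Sum>x\<in>A. eval (f x) p)"
  by (induction A rule: infinite_finite_induct) auto

lemma mono_val_add: "mono_val (m + m') p = mono_val m p * mono_val m' p"
  by (simp add: mono_val_def lookup_add power_add prod.distrib)

lemma sum_of_monomials:
  "f = (\<Sum>m\<in>Poly_Mapping.keys f. Poly_Mapping.single m (Poly_Mapping.lookup f m))"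
  by (rule poly_mapping_eqI)
     (auto simp: lookup_sum lookup_single when_def in_keys_iff)

lemma eval_mult [simp]: "eval (f * g) p = eval f p * eval g p"
proof -
  let ?s = "\<lambda>f m. Poly_Mapping.single m (Poly_Mapping.lookup f m)"
  have "f * g = (\<Sum>m\<in>Poly_Mapping.keys f. ?s f m) * (\<Sum>m\<in>Poly_Mapping.keys g. ?s g m)"
    by (rule arg_cong2[OF sum_of_monomials sum_of_monomials])
  then have "f * g = (\<Sum>m\<in>Poly_Mapping.keys f. \<Sum>m'\<in>Poly_Mapping.keys g. ?s f m * ?s g m')"
    by (simp only: sum_product)
  then have "eval (f * g) p = (\<Sum>m\<in>Poly_Mapping.keys f. \<Sum>m'\<in>Poly_Mapping.keys g.
       (Poly_Mapping.lookup f m * mono_val m p) * (Poly_Mapping.lookup g m' * mono_val m' p))"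
    by (simp add: mult_single eval_single mono_val_add mult_ac)
  then show ?thesis
    by (simp only: sum_product[symmetric] eval_superset[OF finite_keys order_refl, of f]
        eval_superset[OF finite_keys order_refl, of g])
qed

lemma eval_const [simp]: "eval (const c) p = c"
  by (simp add: const_def eval_single mono_val_def)

lemma eval_one [simp]: "eval 1 p = 1"
  using eval_const[of 1 p] by (simp add: const_def)

lemma eval_uminus [simp]: "eval (- f) p = - eval f p"
proof -
  have "eval (- f) p + eval f p = eval (- f + f) p" by (simp only: eval_add)
  then show ?thesis by (simp add: eq_neg_iff_add_eq_0)
qed

lemma eval_diff [simp]: "eval (f - g) p = eval f p - eval g p"
  using eval_add[of f "- g" p] by simp

lemma eval_power [simp]: "eval (f ^ n) p = eval f p ^ n"
  by (induction n) auto

lemma eval_prod [simp]: "eval (\<Prod>x\<in>A. f x) p = (\<Prod>x\<in>A. eval (f x) p)"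
  by (induction A rule: infinite_finite_induct) auto

lemma eval_var [simp]: "eval (var i) p = p i"
proof -
  have "(\<Prod>j\<in>UNIV. p j ^ Poly_Mapping.lookup (Poly_Mapping.single i 1) j) =
        (\<Prod>j\<in>UNIV. if j = i then p i else 1)"
    by (intro prod.cong) (auto simp: lookup_single when_def)
  then show ?thesis by (simp add: var_def eval_single mono_val_def)
qed

text \<open>Distinct monomials are distinct multiplicative characters of the monoid of all points, hence
  linearly independent (Dedekind).\<close>

lemma characters_independent:
  fixes c :: "('n::finite \<Rightarrow>\<^sub>0 nat) \<Rightarrow> 'k::field_char_0"
  assumes "finite K" "\<And>p. (\<Sum>m\<in>K. c m * mono_val m p) = 0" "m \<in> K"
  shows "c m = 0"
  using assms
proof (induction K arbitrary: c m rule: finite_induct)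
  case (insert m0 K)
  have other: "c m1 = 0" if "m1 \<in> K" for m1
  proof -
    have "m1 \<noteq> m0" using that insert.hyps by auto
    then obtain i where i: "Poly_Mapping.lookup m1 i \<noteq> Poly_Mapping.lookup m0 i"
      by (meson poly_mapping_eqI)
    \<comment> \<open>the two monomials take distinct powers of \<open>2\<close> as their values at \<open>q\<close>\<close>
    define q :: "'n \<Rightarrow> 'k" where "q = (\<lambda>j. if j = i then 2 else 1)"
    have val: "mono_val m q = 2 ^ Poly_Mapping.lookup m i" for m
    proof -
      have "mono_val m q = (\<Prod>j\<in>UNIV. if j = i then 2 ^ Poly_Mapping.lookup m i else 1)"
        unfolding mono_val_def q_def by (intro prod.cong) auto
      then show ?thesis by simp
    qed
    have "of_nat (2 ^ Poly_Mapping.lookup m1 i) \<noteq> (of_nat (2 ^ Poly_Mapping.lookup m0 i) :: 'k)"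
      using i by (simp only: of_nat_eq_iff) simp
    then have neq: "mono_val m1 q \<noteq> mono_val m0 q" by (simp add: val)
    have "(\<Sum>m\<in>K. (c m * (mono_val m q - mono_val m0 q)) * mono_val m p) = 0" for p
    proof -
      have pt: "mono_val m (\<lambda>j. q j * p j) = mono_val m q * mono_val m p" for m
        by (simp add: mono_val_def power_mult_distrib prod.distrib)
      have 1: "c m0 * mono_val m0 p + (\<Sum>m\<in>K. c m * mono_val m p) = 0"
        using insert.prems(1)[of p] insert.hyps by simp
      have 2: "c m0 * (mono_val m0 q * mono_val m0 p) +
          (\<Sum>m\<in>K. c m * (mono_val m q * mono_val m p)) = 0"
        using insert.prems(1)[of "\<lambda>j. q j * p j"] insert.hyps by (simp add: pt)
      have "(\<Sum>m\<in>K. (c m * (mono_val m q - mono_val m0 q)) * mono_val m p) =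
          (\<Sum>m\<in>K. c m * (mono_val m q * mono_val m p)) - mono_val m0 q * (\<Sum>m\<in>K. c m * mono_val m p)"
        by (simp add: sum_subtractf sum_distrib_left algebra_simps)
      also have "(\<Sum>m\<in>K. c m * mono_val m p) = - (c m0 * mono_val m0 p)"
        using minus_unique[OF 1] by (rule sym)
      also have "(\<Sum>m\<in>K. c m * (mono_val m q * mono_val m p)) =
          - (c m0 * (mono_val m0 q * mono_val m0 p))"
        using minus_unique[OF 2] by (rule sym)
      finally show ?thesis by simp
    qed
    from insert.IH[OF this that] neq show ?thesis by simp
  qed
  have "c m0 = 0"
    using insert.prems(1)[of "\<lambda>_. 1"] insert.hyps other by (simp add: mono_val_def)
  with other insert.prems(2) show ?case by auto
qed simp

lemma eval_eq_0_imp_eq_0: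
  fixes f :: "('n::finite, 'k::field_char_0) mpoly"
  assumes "\<And>p. eval f p = 0"
  shows "f = 0"
proof (rule poly_mapping_eqI)
  fix m
  have "\<And>p. (\<Sum>m\<in>Poly_Mapping.keys f. Poly_Mapping.lookup f m * mono_val m p) = 0"
    using assms by (simp add: eval_superset[OF finite_keys order_refl])
  from characters_independent[OF finite_keys this, of m]
  show "Poly_Mapping.lookup f m = Poly_Mapping.lookup 0 m"
    by (cases "m \<in> Poly_Mapping.keys f") (auto simp: in_keys_iff)
qed

lemma homogeneous_altdef: "homogeneous d f \<longleftrightarrow> (\<forall>m\<in>Poly_Mapping.keys f. mdeg m = d)"
  by (simp add: homogeneous_def mdeg_def)

lemma mdeg_add: "mdeg (m + m') = mdeg m + mdeg m'"
  by (simp add: mdeg_def lookup_add sum.distrib)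

lemma mdeg_single: "mdeg (Poly_Mapping.single i k) = k"
  by (simp add: mdeg_def lookup_single when_def)

lemma homogeneous_0 [simp]: "homogeneous d 0"
  by (simp add: homogeneous_altdef)

lemma homogeneous_const [simp]: "homogeneous 0 (const c)"
  by (simp add: homogeneous_altdef const_def mdeg_def)

lemma homogeneous_1 [simp]: "homogeneous 0 1"
  using homogeneous_const[of 1] by (simp add: const_def)

lemma homogeneous_var [simp]: "homogeneous 1 (var i)"
  by (simp add: homogeneous_altdef var_def mdeg_single)

lemma homogeneous_add:
  assumes "homogeneous d f" "homogeneous d g"
  shows "homogeneous d (f + g)"
  using assms Poly_Mapping.keys_add[of f g] unfolding homogeneous_altdef by blast

lemma homogeneous_uminus: "homogeneous d f \<Longrightarrow> homogeneous d (- f)"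
  by (auto simp: homogeneous_altdef in_keys_iff)

lemma homogeneous_diff:
  assumes "homogeneous d f" "homogeneous d g"
  shows "homogeneous d (f - g)"
  using homogeneous_add[OF assms(1) homogeneous_uminus[OF assms(2)]] by simp

lemma homogeneous_mult:
  assumes "homogeneous d f" "homogeneous e g"
  shows "homogeneous (d + e) (f * g)"
  using assms Poly_Mapping.keys_mult[of f g] unfolding homogeneous_altdef
  by (force simp: mdeg_add)

lemma homogeneous_power: "homogeneous d f \<Longrightarrow> homogeneous (d * n) (f ^ n)"
  by (induction n) (auto intro: homogeneous_mult)

lemma homogeneous_sum: "(\<And>x. x \<in> A \<Longrightarrow> homogeneous d (f x)) \<Longrightarrow> homogeneous d (\<Sum>x\<in>A. f x)"
  by (induction A rule: infinite_finite_induct) (auto intro: homogeneous_add)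

lemma homogeneous_prod:
  "(\<And>x. x \<in> A \<Longrightarrow> homogeneous (d x) (f x)) \<Longrightarrow> homogeneous (\<Sum>x\<in>A. d x) (\<Prod>x\<in>A. f x)"
  by (induction A rule: infinite_finite_induct) (auto intro: homogeneous_mult)

lemma eval_scale:
  assumes "homogeneous d f"
  shows "eval f (\<lambda>i. c * p i) = c ^ d * eval f p"
proof -
  have "mono_val m (\<lambda>i. c * p i) = c ^ mdeg m * mono_val m p" for m
    by (simp add: mono_val_def mdeg_def power_mult_distrib prod.distrib power_sum)
  then show ?thesis using assms
    by (simp add: eval_superset[OF finite_keys order_refl] homogeneous_altdef
        sum_distrib_left mult_ac)
qed

lemma rational_coeffs_const: "c \<in> \<rat> \<Longrightarrow> rational_coeffs (const c)"
  by (simp add: rational_coeffs_def const_def lookup_single when_def)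

lemma rational_coeffs_var: "rational_coeffs (var i)"
  by (simp add: rational_coeffs_def var_def lookup_single when_def)

lemma rational_coeffs_add: "rational_coeffs f \<Longrightarrow> rational_coeffs g \<Longrightarrow> rational_coeffs (f + g)"
  by (simp add: rational_coeffs_def lookup_add)

lemma rational_coeffs_diff: "rational_coeffs f \<Longrightarrow> rational_coeffs g \<Longrightarrow> rational_coeffs (f - g)"
  by (simp add: rational_coeffs_def lookup_minus)

lemma rational_coeffs_mult:
  assumes "rational_coeffs f" "rational_coeffs g"
  shows "rational_coeffs (f * g)"
proof -
  have S: "Sum_any h \<in> \<rat>" if "\<And>x. h x \<in> \<rat>" for h :: "'c \<Rightarrow> 'b"
    using that by (auto simp: Sum_any.expand_set intro: Rats_sum)
  show ?thesis
    using assms unfolding rational_coeffs_def lookup_mult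
    by (auto intro!: S Rats_mult simp: when_def)
qed

lemma rational_coeffs_power: "rational_coeffs f \<Longrightarrow> rational_coeffs (f ^ n)"
  using rational_coeffs_const[of 1] by (induction n) (auto intro: rational_coeffs_mult simp: const_def)

section \<open>Polynomials in some of the variables\<close>

text \<open>Only the variables in \<open>A\<close> occur in \<open>f\<close>: the outer \<open>keys\<close> are the exponent vectors of \<open>f\<close>, the
  inner ones the variables with a nonzero exponent.\<close>

definition vars_in :: "'n set \<Rightarrow> ('n, 'k::field_char_0) mpoly \<Rightarrow> bool" where
  "vars_in A f \<longleftrightarrow> (\<forall>m\<in>Poly_Mapping.keys f. Poly_Mapping.keys m \<subseteq> A)"

lemma vars_in_UNIV [simp]: "vars_in UNIV f"
  by (simp add: vars_in_def)

lemma vars_in_const [simp]: "vars_in A (const c)"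
  by (simp add: vars_in_def const_def)

lemma vars_in_var: "i \<in> A \<Longrightarrow> vars_in A (var i)"
  by (simp add: vars_in_def var_def)

lemma vars_in_add: "vars_in A f \<Longrightarrow> vars_in A g \<Longrightarrow> vars_in A (f + g)"
  using Poly_Mapping.keys_add[of f g] unfolding vars_in_def by blast

lemma vars_in_uminus: "vars_in A f \<Longrightarrow> vars_in A (- f)"
  by (auto simp: vars_in_def in_keys_iff)

lemma vars_in_diff: "vars_in A f \<Longrightarrow> vars_in A g \<Longrightarrow> vars_in A (f - g)"
  using vars_in_add[of A f "- g"] vars_in_uminus[of A g] by simp

lemma vars_in_mult:
  fixes f g :: "('n, 'k::field_char_0) mpoly"
  assumes "vars_in A f" "vars_in A g"
  shows "vars_in A (f * g)"
  unfolding vars_in_def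
proof
  fix m assume "m \<in> Poly_Mapping.keys (f * g)"
  then obtain a b where "m = a + b" "a \<in> Poly_Mapping.keys f" "b \<in> Poly_Mapping.keys g"
    using Poly_Mapping.keys_mult[of f g] by blast
  then show "Poly_Mapping.keys m \<subseteq> A"
    using assms Poly_Mapping.keys_add[of a b] unfolding vars_in_def by blast
qed

lemma vars_in_mono: "vars_in A f \<Longrightarrow> A \<subseteq> B \<Longrightarrow> vars_in B f"
  by (auto simp: vars_in_def)

lemma eval_cong_vars:
  assumes "vars_in A f" "\<And>i. i \<in> A \<Longrightarrow> p i = q i"
  shows "eval f p = eval f q"
proof -
  have "mono_val m p = mono_val m q" if "m \<in> Poly_Mapping.keys f" for m
    unfolding mono_val_def
  proof (intro prod.cong refl)
    fix i
    have "i \<in> A \<or> Poly_Mapping.lookup m i = 0"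
      using assms(1) that
      by (auto simp: vars_in_def in_keys_iff subset_iff simp del: not_in_keys_iff_lookup_eq_zero)
    then show "p i ^ Poly_Mapping.lookup m i = q i ^ Poly_Mapping.lookup m i"
      using assms(2) by auto
  qed
  then show ?thesis by (simp add: eval_superset[OF finite_keys order_refl])
qed

text \<open>The polynomials in the variables \<open>A\<close> are obtained from the constants by addition and by
  multiplication with variables in \<open>A\<close>.\<close>

lemma mpoly_induct [consumes 1, case_names const var_mult add]:
  fixes f :: "('n::finite, 'k::field_char_0) mpoly"
  assumes f: "vars_in A f"
    and c: "\<And>c. P (const c)"
    and v: "\<And>f i. vars_in A f \<Longrightarrow> P f \<Longrightarrow> i \<in> A \<Longrightarrow> P (var i * f)"
    and a: "\<And>f g. vars_in A f \<Longrightarrow> vars_in A g \<Longrightarrow> P f \<Longrightarrow> P g \<Longrightarrow> P (f + g)"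
  shows "P f"
proof -
  have single: "Poly_Mapping.keys m \<subseteq> A \<Longrightarrow> P (Poly_Mapping.single m c)" for m c
  proof (induction "mdeg m" arbitrary: m)
    case 0
    then have "m = 0" by (intro poly_mapping_eqI) (simp add: mdeg_def)
    then show ?case using c by (simp add: const_def)
  next
    case (Suc n)
    then obtain i where i: "Poly_Mapping.lookup m i \<noteq> 0"
      by (metis mdeg_def nat.distinct(1) sum.neutral)
    define m' where "m' = m - Poly_Mapping.single i 1"
    have m: "m = Poly_Mapping.single i 1 + m'"
      using i by (intro poly_mapping_eqI)
        (auto simp: m'_def lookup_add lookup_minus lookup_single when_def)
    have sub: "Poly_Mapping.keys m' \<subseteq> A" using Suc.prems
      by (auto simp: m in_keys_iff lookup_add)
    have "n = mdeg m'" using Suc.hyps(2) by (simp add: m mdeg_add mdeg_single)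
    then have "P (var i * Poly_Mapping.single m' c)"
      using Suc.hyps(1) sub i Suc.prems
      by (intro v) (auto simp: vars_in_def in_keys_iff split: if_splits)
    then show ?case by (simp add: var_def mult_single m)
  qed
  have "vars_in A (\<Sum>m\<in>K. Poly_Mapping.single m (Poly_Mapping.lookup f m)) \<and>
        P (\<Sum>m\<in>K. Poly_Mapping.single m (Poly_Mapping.lookup f m))"
    if "K \<subseteq> Poly_Mapping.keys f" for K
    using finite_subset[OF that finite_keys] that
  proof (induction K rule: finite_induct)
    case empty
    then show ?case using c[of 0] by (simp add: const_def vars_in_def)
  next
    case (insert m K)
    then have k: "Poly_Mapping.keys m \<subseteq> A" using f by (auto simp: vars_in_def)
    then have "vars_in A (Poly_Mapping.single m (Poly_Mapping.lookup f m))"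
      by (simp add: vars_in_def)
    then show ?case using insert single[OF k] by (auto intro: vars_in_add a)
  qed
  from this[OF order_refl] show ?thesis
    unfolding sum_of_monomials[of f, symmetric] by (rule conjunct2)
qed

text \<open>Substituting polynomials for the variables.\<close>

definition subst ::
  "('m::finite, 'k::field_char_0) mpoly \<Rightarrow> ('m \<Rightarrow> ('n::finite, 'k) mpoly) \<Rightarrow> ('n, 'k) mpoly" where
  "subst f F = (\<Sum>m\<in>Poly_Mapping.keys f.
     const (Poly_Mapping.lookup f m) * (\<Prod>j\<in>UNIV. F j ^ Poly_Mapping.lookup m j))"

lemma eval_subst: "eval (subst f F) p = eval f (eval_map F p)"
  by (simp add: subst_def eval_map_def eval_superset[of "Poly_Mapping.keys f"] mono_val_def)

lemma homogeneous_subst: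
  assumes "homogeneous d f" "\<And>j. homogeneous e (F j)"
  shows "homogeneous (e * d) (subst f F)"
  unfolding subst_def
proof (rule homogeneous_sum)
  fix m assume m: "m \<in> Poly_Mapping.keys f"
  have "homogeneous (0 + (\<Sum>j\<in>UNIV. e * Poly_Mapping.lookup m j))
     (const (Poly_Mapping.lookup f m) * (\<Prod>j\<in>UNIV. F j ^ Poly_Mapping.lookup m j))"
    by (intro homogeneous_mult homogeneous_prod homogeneous_power assms homogeneous_const)
  then show "homogeneous (e * d)
     (const (Poly_Mapping.lookup f m) * (\<Prod>j\<in>UNIV. F j ^ Poly_Mapping.lookup m j))"
    using assms(1) m by (simp add: homogeneous_def flip: sum_distrib_left)
qed

text \<open>Two polynomials that do not vanish identically do not vanish at some common point: on the
  line joining a non-zero of each they restrict to nonzero univariate polynomials.\<close>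

lemma common_nonzero:
  fixes f g :: "('n::finite, 'k::field_char_0) mpoly"
  assumes "eval f p \<noteq> 0" "eval g q \<noteq> 0"
  shows "\<exists>r. eval f r \<noteq> 0 \<and> eval g r \<noteq> 0"
proof -
  define L where "L = (\<lambda>s i. p i + s * (q i - p i))"
  have L01: "L 0 = p" "L 1 = q" by (auto simp: L_def)
  have ex: "\<exists>P. \<forall>s. eval f (L s) = poly P s" for f
    using vars_in_UNIV[of f]
  proof (induction rule: mpoly_induct)
    case (const c)
    show ?case by (rule exI[of _ "[:c:]"]) simp
  next
    case (var_mult f i)
    then obtain P where "\<forall>s. eval f (L s) = poly P s" by auto
    then show ?case
      by (intro exI[of _ "[:p i, q i - p i:] * P"]) (simp add: L_def algebra_simps)
  next
    case (add f g)
    then obtain P Q where "\<forall>s. eval f (L s) = poly P s" "\<forall>s. eval g (L s) = poly Q s" by auto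
    then show ?case by (intro exI[of _ "P + Q"]) simp
  qed
  obtain P Q where P: "\<And>s. eval f (L s) = poly P s" and Q: "\<And>s. eval g (L s) = poly Q s"
    using ex by metis
  have "P \<noteq> 0" "Q \<noteq> 0" using P[of 0] Q[of 1] assms by (auto simp: L01)
  then have "finite {s. poly (P * Q) s = 0}" by (intro poly_roots_finite) auto
  then obtain s where "poly (P * Q) s \<noteq> 0"
    using infinite_UNIV_char_0[where 'a = 'k] by (metis (mono_tags) ex_new_if_finite mem_Collect_eq)
  then show ?thesis by (intro exI[of _ "L s"]) (simp add: P Q)
qed

section \<open>Irreducible closed sets\<close>

lemma closed_separating_form:
  assumes "zariski_closed Z" "p \<in> proj_space" "p \<notin> Z"
  obtains f d where "homogeneous d f" "\<And>q. q \<in> Z \<Longrightarrow> eval f q = 0" "eval f p \<noteq> 0"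
  using assms unfolding zariski_closed_def zero_locus_def by blast

lemma zariski_closed_imp_proj: "zariski_closed Z \<Longrightarrow> Z \<subseteq> proj_space"
  by (auto simp: zariski_closed_def zero_locus_def)

lemma zariski_closed_Int_form:
  assumes "zariski_closed Z" "homogeneous d f"
  shows "zariski_closed {p \<in> Z. eval f p = 0}"
proof -
  obtain S where S: "\<forall>f\<in>S. \<exists>d. homogeneous d f" "Z = zero_locus S"
    using assms(1) by (auto simp: zariski_closed_def)
  have "{p \<in> Z. eval f p = 0} = zero_locus (insert f S)"
    by (auto simp: S(2) zero_locus_def)
  then show ?thesis using S(1) assms(2) unfolding zariski_closed_def by blast
qed

lemma irreducible_closed_prime:
  assumes irr: "irreducible_closed Z" and f: "homogeneous d f" and g: "homogeneous e g"
    and fg: "\<And>p. p \<in> Z \<Longrightarrow> eval f p * eval g p = 0"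
  shows "(\<forall>p\<in>Z. eval f p = 0) \<or> (\<forall>p\<in>Z. eval g p = 0)"
proof -
  let ?A = "{p \<in> Z. eval f p = 0}" and ?B = "{p \<in> Z. eval g p = 0}"
  have Z: "zariski_closed Z" using irr by (simp add: irreducible_closed_def)
  have "Z = ?A \<union> ?B" using fg by auto
  then have "Z = ?A \<or> Z = ?B"
    using irr zariski_closed_Int_form[OF Z f] zariski_closed_Int_form[OF Z g]
    unfolding irreducible_closed_def by blast
  then show ?thesis by blast
qed

text \<open>A closed set with a dense polynomial parametrization is irreducible. Density is expressed by
  the forms that vanish on the image. The parametrization may be undefined (zero) at some points.\<close>

lemma irreducible_closed_parametrized:
  fixes F :: "'m::finite \<Rightarrow> ('n::finite, 'k::field_char_0) mpoly"
  assumes closed: "zariski_closed V" and ne: "V \<noteq> {}"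
    and into: "\<And>p. eval_map F p \<noteq> (\<lambda>_. 0) \<Longrightarrow> eval_map F p \<in> V"
    and dense: "\<And>f d q. homogeneous d f \<Longrightarrow>
      (\<And>p. eval_map F p \<noteq> (\<lambda>_. 0) \<Longrightarrow> eval f (eval_map F p) = 0) \<Longrightarrow> q \<in> V \<Longrightarrow> eval f q = 0"
  shows "irreducible_closed V"
  unfolding irreducible_closed_def
proof (intro conjI allI impI closed ne)
  fix A B assume AB: "zariski_closed A \<and> zariski_closed B \<and> V = A \<union> B"
  show "V = A \<or> V = B"
  proof (rule ccontr)
    assume "\<not> (V = A \<or> V = B)"
    then obtain a b where ab: "a \<in> V" "a \<notin> A" "b \<in> V" "b \<notin> B" using AB by blast
    have V: "V \<subseteq> proj_space" using closed by (rule zariski_closed_imp_proj)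
    have cl: "zariski_closed A" "zariski_closed B" and pr: "a \<in> proj_space" "b \<in> proj_space"
      using AB ab V by auto
    obtain f d where f: "homogeneous d f" "\<And>q. q \<in> A \<Longrightarrow> eval f q = 0" "eval f a \<noteq> 0"
      by (rule closed_separating_form[OF cl(1) pr(1) ab(2)]) blast
    obtain g e where g: "homogeneous e g" "\<And>q. q \<in> B \<Longrightarrow> eval g q = 0" "eval g b \<noteq> 0"
      by (rule closed_separating_form[OF cl(2) pr(2) ab(4)]) blast
    obtain p where p: "eval_map F p \<noteq> (\<lambda>_. 0)" "eval f (eval_map F p) \<noteq> 0"
      using dense[OF f(1) _ ab(1)] f(3) by blast
    obtain q where q: "eval_map F q \<noteq> (\<lambda>_. 0)" "eval g (eval_map F q) \<noteq> 0"
      using dense[OF g(1) _ ab(3)] g(3) by blast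
    obtain j where "eval (F j) p \<noteq> 0" using p(1) by (auto simp: eval_map_def)
    with p(2) have "eval (subst f F * F j) p \<noteq> 0" by (simp add: eval_subst)
    moreover have "eval (subst g F) q \<noteq> 0" using q by (simp add: eval_subst)
    ultimately obtain r where r: "eval (subst f F * F j) r \<noteq> 0" "eval (subst g F) r \<noteq> 0"
      using common_nonzero by blast
    then have "eval_map F r \<noteq> (\<lambda>_. 0)" by (auto simp: eval_map_def fun_eq_iff)
    then have "eval_map F r \<in> A \<union> B" using into AB by blast
    then show False using r f(2) g(2) by (auto simp: eval_subst)
  qed
qed

section \<open>An upper bound for the dimension\<close>

text \<open>A homogeneous linear system with fewer equations than unknowns has a nontrivial solution, by
  elimination of one unknown for each equation.\<close>

lemma underdetermined_system:
  fixes a :: "'j \<Rightarrow> 'i \<Rightarrow> 'k::field"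
  assumes "finite J" "finite I" "card J < card I"
  shows "\<exists>c. (\<exists>i\<in>I. c i \<noteq> 0) \<and> (\<forall>j\<in>J. (\<Sum>i\<in>I. a j i * c i) = 0)"
  using assms
proof (induction J arbitrary: I a rule: finite_induct)
  case empty
  then have "I \<noteq> {}" by auto
  then show ?case by (intro exI[of _ "\<lambda>_. 1"]) auto
next
  case (insert j0 J)
  show ?case
  proof (cases "\<forall>i\<in>I. a j0 i = 0")
    case True
    have "card J < card I" using insert by simp
    from insert.IH[OF insert.prems(1) this, of a] True show ?thesis by auto
  next
    case False
    then obtain i0 where i0: "i0 \<in> I" "a j0 i0 \<noteq> 0" by auto
    let ?I = "I - {i0}"
    have "card J < card ?I" using insert i0 by simp
    moreover have "finite ?I" using insert by simp
    ultimately obtain c where c: "\<exists>i\<in>?I. c i \<noteq> 0"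
      "\<And>j. j \<in> J \<Longrightarrow> (\<Sum>i\<in>?I. (a j i - a j i0 * a j0 i / a j0 i0) * c i) = 0"
      using insert.IH[of ?I "\<lambda>j i. a j i - a j i0 * a j0 i / a j0 i0"] by blast
    define s where "s = (\<Sum>i\<in>?I. a j0 i * c i)"
    define c' where "c' = c(i0 := - s / a j0 i0)"
    have split: "(\<Sum>i\<in>I. a j i * c' i) = a j i0 * (- s / a j0 i0) + (\<Sum>i\<in>?I. a j i * c i)" for j
      using insert.prems(1) i0(1) by (simp add: sum.remove c'_def)
    have "(\<Sum>i\<in>I. a j i * c' i) = 0" if "j \<in> J" for j
    proof -
      have "(\<Sum>i\<in>?I. a j i * c i) - a j i0 / a j0 i0 * s =
          (\<Sum>i\<in>?I. (a j i - a j i0 * a j0 i / a j0 i0) * c i)"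
        by (simp add: s_def sum_distrib_left sum_subtractf algebra_simps)
      then show ?thesis using c(2)[OF that] by (simp add: split)
    qed
    moreover have "(\<Sum>i\<in>I. a j0 i * c' i) = 0"
      using i0(2) by (simp add: split flip: s_def)
    moreover have "\<exists>i\<in>I. c' i \<noteq> 0" using c(1) by (auto simp: c'_def)
    ultimately show ?thesis by blast
  qed
qed

text \<open>For a fixed total degree, the exponents of all variables but one determine the monomial.\<close>

lemma card_monomials_of_degree:
  fixes D :: nat
  defines "K \<equiv> {m :: 'n::finite \<Rightarrow>\<^sub>0 nat. mdeg m = D}"
  shows "finite K" "card K \<le> (D + 1) ^ (CARD('n) - 1)"
proof -
  obtain i0 :: 'n where True by blast
  let ?R = "\<lambda>m :: 'n \<Rightarrow>\<^sub>0 nat. restrict (Poly_Mapping.lookup m) (UNIV - {i0})"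
  let ?P = "PiE (UNIV - {i0}) (\<lambda>_. {..D})"
  have deg: "mdeg m = Poly_Mapping.lookup m i0 + (\<Sum>i\<in>UNIV - {i0}. Poly_Mapping.lookup m i)"
    for m :: "'n \<Rightarrow>\<^sub>0 nat"
    by (simp add: mdeg_def sum.remove[of UNIV i0])
  have "inj_on ?R K"
  proof (rule inj_onI)
    fix m m' assume K: "m \<in> K" "m' \<in> K" and eq: "?R m = ?R m'"
    have other: "Poly_Mapping.lookup m i = Poly_Mapping.lookup m' i" if "i \<noteq> i0" for i
      using fun_cong[OF eq, of i] that by simp
    then have "(\<Sum>i\<in>UNIV - {i0}. Poly_Mapping.lookup m i) = (\<Sum>i\<in>UNIV - {i0}. Poly_Mapping.lookup m' i)"
      by (intro sum.cong) auto
    then have "Poly_Mapping.lookup m i0 = Poly_Mapping.lookup m' i0"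
      using K by (simp add: K_def deg)
    with other show "m = m'" by (intro poly_mapping_eqI) metis
  qed
  moreover have "?R ` K \<subseteq> ?P"
  proof -
    have "Poly_Mapping.lookup m i \<le> mdeg m" for m :: "'n \<Rightarrow>\<^sub>0 nat" and i
      unfolding mdeg_def by (rule member_le_sum) auto
    then show ?thesis by (auto simp: K_def split: if_splits)
  qed
  moreover have "finite ?P" by (intro finite_PiE) auto
  ultimately show "finite K" "card K \<le> (D + 1) ^ (CARD('n) - 1)"
    using inj_on_finite[of ?R K ?P] card_inj_on_le[of ?R K ?P] by (simp_all add: card_PiE)
qed

text \<open>Forms cutting the members of a chain of irreducible closed sets out of each other are
  algebraically independent on the largest member. A power of a further coordinate, not vanishing
  on the smallest member, brings all monomials in these forms to a common degree \<open>M\<close>. Exponent vectors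
  are functions \<open>e\<close> of which only the values below \<open>n\<close> matter; therefore \<open>E\<close> is to contain at most one
  function for each choice of these values.\<close>

lemma chain_forms_independent:
  fixes Z :: "nat \<Rightarrow> ('n::finite \<Rightarrow> 'k::field_char_0) set"
    and f :: "nat \<Rightarrow> ('n, 'k) mpoly"
  assumes "\<And>i. i \<le> n \<Longrightarrow> irreducible_closed (Z i)"
    and "\<And>i. i < n \<Longrightarrow> Z i \<subseteq> Z (Suc i)"
    and "\<And>i. i < n \<Longrightarrow> homogeneous (d i) (f i)"
    and "\<And>i p. i < n \<Longrightarrow> p \<in> Z i \<Longrightarrow> eval (f i) p = 0"
    and "\<And>i. i < n \<Longrightarrow> \<exists>p\<in>Z (Suc i). eval (f i) p \<noteq> 0"
    and "\<exists>p\<in>Z 0. p j \<noteq> 0"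
    and "finite E" "inj_on (\<lambda>e. restrict e {..<n}) E"
    and "\<And>e. e \<in> E \<Longrightarrow> (\<Sum>i<n. d i * e i) \<le> M"
    and "\<And>p. p \<in> Z n \<Longrightarrow> (\<Sum>e\<in>E. c e *
           (p j ^ (M - (\<Sum>i<n. d i * e i)) * (\<Prod>i<n. eval (f i) p ^ e i))) = 0"
    and "e \<in> E"
  shows "c e = 0"
  using assms
proof (induction n arbitrary: E M c e)
  case 0
  then have "E = {e}" by (auto simp: inj_on_def restrict_def)
  then show ?case using "0.prems"(6,10) by auto
next
  case (Suc n)
  define E' where "E' = {e \<in> E. c e \<noteq> 0}"
  show ?case
  proof (rule ccontr)
    assume "c e \<noteq> 0"
    then have ne: "E' \<noteq> {}" using Suc.prems by (auto simp: E'_def)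
    have fin: "finite E'" using Suc.prems by (simp add: E'_def)
    \<comment> \<open>the largest power of \<open>f n\<close> dividing the whole relation is split off\<close>
    define m where "m = Min ((\<lambda>e. e n) ` E')"
    have m_le: "m \<le> e n" if "e \<in> E'" for e using fin that by (simp add: m_def)
    have "m \<in> (\<lambda>e. e n) ` E'" unfolding m_def using fin ne by (intro Min_in) auto
    then obtain e0 where e0: "e0 \<in> E'" "e0 n = m" by auto
    define G where "G = (\<Sum>e\<in>E'. const (c e) * (var j ^ (M - (\<Sum>i<Suc n. d i * e i)) *
        ((\<Prod>i<n. f i ^ e i) * f n ^ (e n - m))))"
    have le: "(\<Sum>i<n. d i * e i) + d n * e n \<le> M" if "e \<in> E'" for e
      using Suc.prems(9)[of e] that by (simp add: E'_def)
    have homG: "homogeneous (M - d n * m) G"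
      unfolding G_def
    proof (rule homogeneous_sum)
      fix e assume e: "e \<in> E'"
      have "homogeneous (0 + (1 * (M - (\<Sum>i<Suc n. d i * e i)) +
           ((\<Sum>i<n. d i * e i) + d n * (e n - m))))
        (const (c e) * (var j ^ (M - (\<Sum>i<Suc n. d i * e i)) *
          ((\<Prod>i<n. f i ^ e i) * f n ^ (e n - m))))"
        using Suc.prems(3)
        by (intro homogeneous_mult homogeneous_const homogeneous_power homogeneous_prod homogeneous_var)
           auto
      moreover have "(M - (\<Sum>i<Suc n. d i * e i)) + ((\<Sum>i<n. d i * e i) + d n * (e n - m)) = M - d n * m"
      proof -
        have "d n * m \<le> d n * e n" using m_le[OF e] by simp
        then show ?thesis using le[OF e] unfolding diff_mult_distrib2 sum.lessThan_Suc by linarith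
      qed
      ultimately show "homogeneous (M - d n * m) (const (c e) * (var j ^ (M - (\<Sum>i<Suc n. d i * e i)) *
          ((\<Prod>i<n. f i ^ e i) * f n ^ (e n - m))))" by simp
    qed
    have "eval (f n ^ m) p * eval G p = 0" if p: "p \<in> Z (Suc n)" for p
    proof -
      have "eval (f n ^ m) p * eval G p = (\<Sum>e\<in>E'. c e *
           (p j ^ (M - (\<Sum>i<Suc n. d i * e i)) * (\<Prod>i<Suc n. eval (f i) p ^ e i)))"
        unfolding G_def eval_sum sum_distrib_left
      proof (intro sum.cong refl)
        fix e assume "e \<in> E'"
        then have "eval (f n) p ^ e n = eval (f n) p ^ m * eval (f n) p ^ (e n - m)"
          using m_le by (simp flip: power_add)
        then show "eval (f n ^ m) p * eval (const (c e) * (var j ^ (M - (\<Sum>i<Suc n. d i * e i)) *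
            ((\<Prod>i<n. f i ^ e i) * f n ^ (e n - m)))) p =
          c e * (p j ^ (M - (\<Sum>i<Suc n. d i * e i)) * (\<Prod>i<Suc n. eval (f i) p ^ e i))"
          by (simp only: eval_mult eval_power eval_const eval_var eval_prod prod.lessThan_Suc mult_ac)
      qed
      also have "\<dots> = (\<Sum>e\<in>E. c e *
           (p j ^ (M - (\<Sum>i<Suc n. d i * e i)) * (\<Prod>i<Suc n. eval (f i) p ^ e i)))"
        using Suc.prems(7) by (intro sum.mono_neutral_left) (auto simp: E'_def)
      finally show ?thesis using Suc.prems(10)[OF p] by simp
    qed
    then have "(\<forall>p\<in>Z (Suc n). eval (f n ^ m) p = 0) \<or> (\<forall>p\<in>Z (Suc n). eval G p = 0)"
      using Suc.prems(1,3) homG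
      by (intro irreducible_closed_prime[of _ "d n * m" _ "M - d n * m"] homogeneous_power) auto
    moreover obtain p where "p \<in> Z (Suc n)" "eval (f n) p \<noteq> 0" using Suc.prems(5)[of n] by auto
    ultimately have G0: "eval G p = 0" if "p \<in> Z (Suc n)" for p using that by auto
    \<comment> \<open>on \<open>Z n\<close>, where \<open>f n\<close> vanishes, only the terms with \<open>e n = m\<close> survive\<close>
    define E0 where "E0 = {e \<in> E'. e n = m}"
    have "c e0 = 0"
    proof (rule Suc.IH[where E = E0 and M = "M - d n * m" and c = c and e = e0])
      show "finite E0" using fin by (simp add: E0_def)
      show "inj_on (\<lambda>e. restrict e {..<n}) E0"
      proof (rule inj_onI)
        fix e e' assume *: "e \<in> E0" "e' \<in> E0" "restrict e {..<n} = restrict e' {..<n}"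
        have "restrict e {..<Suc n} = restrict e' {..<Suc n}"
        proof
          fix i show "restrict e {..<Suc n} i = restrict e' {..<Suc n} i"
            using fun_cong[OF *(3), of i] *(1,2)
            by (cases "i = n") (auto simp: restrict_def E0_def split: if_splits)
        qed
        then show "e = e'"
          using *(1,2) Suc.prems(8) unfolding inj_on_def E0_def E'_def by blast
      qed
      show "(\<Sum>i<n. d i * e i) \<le> M - d n * m" if "e \<in> E0" for e
        using le[of e] that by (auto simp: E0_def)
      show "e0 \<in> E0" using e0 by (simp add: E0_def)
      fix p assume p: "p \<in> Z n"
      have fn: "eval (f n) p = 0" using Suc.prems(4)[of n p] p by simp
      have "eval G p = 0" using G0 Suc.prems(2)[of n] p by auto
      moreover have "eval G p = (\<Sum>e\<in>E0. c e *
           (p j ^ (M - d n * m - (\<Sum>i<n. d i * e i)) * (\<Prod>i<n. eval (f i) p ^ e i)))"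
        unfolding G_def eval_sum
      proof (rule sum.mono_neutral_cong_right[OF fin])
        show "\<forall>e\<in>E' - E0. eval (const (c e) * (var j ^ (M - (\<Sum>i<Suc n. d i * e i)) *
            ((\<Prod>i<n. f i ^ e i) * f n ^ (e n - m)))) p = 0"
        proof
          fix e assume e: "e \<in> E' - E0"
          then have "e n - m \<noteq> 0" using m_le[of e] by (auto simp: E0_def)
          then show "eval (const (c e) * (var j ^ (M - (\<Sum>i<Suc n. d i * e i)) *
            ((\<Prod>i<n. f i ^ e i) * f n ^ (e n - m)))) p = 0" by (simp add: fn)
        qed
      qed (auto simp: E0_def add.commute)
      ultimately show "(\<Sum>e\<in>E0. c e *
           (p j ^ (M - d n * m - (\<Sum>i<n. d i * e i)) * (\<Prod>i<n. eval (f i) p ^ e i))) = 0" by simp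
    qed (use Suc.prems in auto)
    then show False using e0 by (simp add: E'_def)
  qed
qed

text \<open>A set dominated by forms in \<open>N\<close> variables has dimension at most \<open>N - 1\<close>: a longer chain
  would yield \<open>N\<close> forms as in \<open>chain_forms_independent\<close>. Pulled back along the parametrization, the
  \<open>(m + 1) ^ N\<close> products with exponents at most \<open>m\<close> in these forms lie in a space of forms in \<open>N\<close>
  variables whose dimension is \<open>O(m ^ (N - 1))\<close>, so they are linearly dependent for large \<open>m\<close>.\<close>

lemma proj_dim_le_parametrized:
  fixes F :: "'m::finite \<Rightarrow> ('n::finite, 'k::field_char_0) mpoly"
  assumes hom: "\<And>j. homogeneous \<delta> (F j)"
    and dense: "\<And>f d q. homogeneous d f \<Longrightarrow>
      (\<And>p. eval f (eval_map F p) = 0) \<Longrightarrow> q \<in> V \<Longrightarrow> eval f q = 0"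
  shows "proj_dim V \<le> enat (CARD('n) - 1)"
  unfolding proj_dim_def
proof (rule SUP_least, clarify)
  fix n :: nat and Z :: "nat \<Rightarrow> ('m \<Rightarrow> 'k) set"
  assume irr: "\<forall>i\<le>n. irreducible_closed (Z i) \<and> Z i \<subseteq> V" and chain: "\<forall>i<n. Z i \<subset> Z (Suc i)"
  define N where "N = CARD('n)"
  have N: "N > 0" by (simp add: N_def card_gt_0_iff)
  have "n \<le> N - 1"
  proof (rule ccontr)
    assume "\<not> n \<le> N - 1"
    then have n: "N \<le> n" by simp
    have "\<exists>f d. homogeneous d f \<and> (\<forall>p\<in>Z i. eval f p = 0) \<and> (\<exists>p\<in>Z (Suc i). eval f p \<noteq> 0)"
      if i: "i < N" for i
    proof -
      have "Z i \<subset> Z (Suc i)" using chain i n by simp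
      then obtain p where p: "p \<in> Z (Suc i)" "p \<notin> Z i" by blast
      have cl: "zariski_closed (Z i)" "zariski_closed (Z (Suc i))"
        using irr i n by (auto simp: irreducible_closed_def)
      then have "p \<in> proj_space" using p zariski_closed_imp_proj by blast
      then show ?thesis
        by (rule closed_separating_form[OF cl(1) _ p(2)]) (use p(1) in blast)
    qed
    then obtain f d where f: "\<And>i. i < N \<Longrightarrow> homogeneous (d i) (f i)"
      "\<And>i p. i < N \<Longrightarrow> p \<in> Z i \<Longrightarrow> eval (f i) p = 0"
      "\<And>i. i < N \<Longrightarrow> \<exists>p\<in>Z (Suc i). eval (f i) p \<noteq> 0"
      by metis
    have Z0: "zariski_closed (Z 0)" "Z 0 \<noteq> {}" using irr by (auto simp: irreducible_closed_def)
    then obtain p0 where p0: "p0 \<in> Z 0" by blast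
    then have "p0 \<noteq> (\<lambda>_. 0)" using zariski_closed_imp_proj[OF Z0(1)] by (auto simp: proj_space_def)
    then obtain j where j: "p0 j \<noteq> 0" by auto
    define S where "S = (\<Sum>i<N. d i)"
    \<comment> \<open>large enough for \<open>(m + 1) ^ N > (\<delta> * (m * S) + 1) ^ (N - 1)\<close>\<close>
    define m where "m = (\<delta> * S + 1) ^ (N - 1)"
    define M where "M = m * S"
    define E where "E = PiE {..<N} (\<lambda>_. {..m})"
    define K where "K = {k :: 'n \<Rightarrow>\<^sub>0 nat. mdeg k = \<delta> * M}"
    have finE: "finite E" by (simp add: E_def finite_PiE)
    have cardE: "card E = (m + 1) ^ N" by (simp add: E_def card_PiE)
    have "card K \<le> (\<delta> * M + 1) ^ (N - 1)"
      unfolding K_def N_def by (rule card_monomials_of_degree)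
    also have "\<dots> \<le> ((\<delta> * S + 1) * (m + 1)) ^ (N - 1)"
      by (intro power_mono) (auto simp: M_def algebra_simps)
    also have "\<dots> = m * (m + 1) ^ (N - 1)" by (simp only: power_mult_distrib m_def)
    also have "\<dots> < (m + 1) * (m + 1) ^ (N - 1)" by simp
    also have "\<dots> = card E" using N by (simp add: cardE flip: power_Suc)
    finally have card: "card K < card E" .
    define T where "T = (\<lambda>e. var j ^ (M - (\<Sum>i<N. d i * e i)) * (\<Prod>i<N. f i ^ e i))"
    have le: "(\<Sum>i<N. d i * e i) \<le> M" if "e \<in> E" for e
    proof -
      have "(\<Sum>i<N. d i * e i) \<le> (\<Sum>i<N. d i * m)"
        using that by (intro sum_mono mult_left_mono) (auto simp: E_def)
      then show ?thesis by (simp add: M_def S_def sum_distrib_left mult.commute)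
    qed
    have homT: "homogeneous M (T e)" if "e \<in> E" for e
    proof -
      have "homogeneous (1 * (M - (\<Sum>i<N. d i * e i)) + (\<Sum>i<N. d i * e i)) (T e)"
        unfolding T_def using f(1)
        by (intro homogeneous_mult homogeneous_power homogeneous_prod homogeneous_var) auto
      then show ?thesis using le[OF that] by simp
    qed
    obtain c where c: "\<exists>e\<in>E. c e \<noteq> 0"
      "\<And>k. k \<in> K \<Longrightarrow> (\<Sum>e\<in>E. Poly_Mapping.lookup (subst (T e) F) k * c e) = 0"
      using underdetermined_system[of K E "\<lambda>k e. Poly_Mapping.lookup (subst (T e) F) k"] card finE
        card_monomials_of_degree(1)[where 'n = 'n] by (auto simp: K_def)
    have rel: "(\<Sum>e\<in>E. const (c e) * subst (T e) F) = 0"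
    proof (rule poly_mapping_eqI)
      fix k
      have lk: "Poly_Mapping.lookup (const x * g) k = x * Poly_Mapping.lookup g k"
        for x and g :: "('n, 'k) mpoly"
        by (simp add: const_def map.rep_eq when_def flip: mult_map_scale_conv_mult)
      show "Poly_Mapping.lookup (\<Sum>e\<in>E. const (c e) * subst (T e) F) k = Poly_Mapping.lookup 0 k"
      proof (cases "k \<in> K")
        case True
        then show ?thesis using c(2) by (simp add: lookup_sum lk mult.commute)
      next
        case False
        have "Poly_Mapping.lookup (subst (T e) F) k = 0" if "e \<in> E" for e
        proof (rule ccontr)
          assume "Poly_Mapping.lookup (subst (T e) F) k \<noteq> 0"
          then have "mdeg k = \<delta> * M"
            using homogeneous_subst[OF homT[OF that] hom]
            by (auto simp: homogeneous_altdef in_keys_iff)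
          with False show False by (simp add: K_def)
        qed
        then show ?thesis by (simp add: lookup_sum lk)
      qed
    qed
    define R where "R = (\<Sum>e\<in>E. const (c e) * T e)"
    have "homogeneous (0 + M) R"
      unfolding R_def using homT by (intro homogeneous_sum homogeneous_mult homogeneous_const)
    moreover have "eval R (eval_map F p) = 0" for p
      using arg_cong[OF rel, of "\<lambda>g. eval g p"] by (simp add: R_def eval_subst)
    ultimately have R0: "eval R q = 0" if "q \<in> Z N" for q
      using dense[of "0 + M" R q] that irr n by blast
    have "c e = 0" if "e \<in> E" for e
    proof (rule chain_forms_independent[where n = N and Z = Z and d = d and f = f and j = j
          and E = E and M = M and c = c])
      show "Z i \<subseteq> Z (Suc i)" if "i < N" for i
        using chain that n by (simp add: psubset_imp_subset)
      show "inj_on (\<lambda>e. restrict e {..<N}) E"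
        by (auto simp: inj_on_def E_def)
      show "(\<Sum>e\<in>E. c e * (p j ^ (M - (\<Sum>i<N. d i * e i)) * (\<Prod>i<N. eval (f i) p ^ e i))) = 0"
        if "p \<in> Z N" for p
        using R0[OF that] by (simp add: R_def T_def)
    qed (use irr chain n f p0 j finE le that in auto)
    then show False using c(1) by blast
  qed
  then show "enat n \<le> enat (CARD('n) - 1)" by (simp add: N_def)
qed

section \<open>Elimination of square roots\<close>

text \<open>The ideal generated by \<open>Q\<close>, for finite \<open>Q\<close>. (The sum is \<open>0\<close> for infinite \<open>Q\<close>.)\<close>

definition ideal_of :: "('n, 'k::field_char_0) mpoly set \<Rightarrow> ('n, 'k) mpoly set" where
  "ideal_of Q = {f. \<exists>c. f = (\<Sum>q\<in>Q. c q * q)}"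

lemma ideal_of_add: "f \<in> ideal_of Q \<Longrightarrow> g \<in> ideal_of Q \<Longrightarrow> f + g \<in> ideal_of Q"
proof -
  assume "f \<in> ideal_of Q" "g \<in> ideal_of Q"
  then obtain c c' where "f = (\<Sum>q\<in>Q. c q * q)" "g = (\<Sum>q\<in>Q. c' q * q)"
    by (auto simp: ideal_of_def)
  then have "f + g = (\<Sum>q\<in>Q. (c q + c' q) * q)" by (simp add: sum.distrib distrib_right)
  then show ?thesis by (auto simp: ideal_of_def)
qed

lemma ideal_of_mult: "f \<in> ideal_of Q \<Longrightarrow> g * f \<in> ideal_of Q"
proof -
  assume "f \<in> ideal_of Q"
  then obtain c where "f = (\<Sum>q\<in>Q. c q * q)" by (auto simp: ideal_of_def)
  then have "g * f = (\<Sum>q\<in>Q. (g * c q) * q)" by (simp add: sum_distrib_left mult_ac)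
  then show ?thesis unfolding ideal_of_def by (intro CollectI exI[of _ "\<lambda>q. g * c q"])
qed

lemma ideal_of_zero: "0 \<in> ideal_of Q"
  by (auto simp: ideal_of_def intro: exI[of _ "\<lambda>_. 0"])

lemma ideal_of_generator: "finite Q \<Longrightarrow> q \<in> Q \<Longrightarrow> q \<in> ideal_of Q"
  unfolding ideal_of_def
  by (intro CollectI exI[of _ "\<lambda>q'. if q' = q then 1 else 0"])
     (simp add: if_distribR if_distrib[of "\<lambda>x. x * _"] cong: if_cong)

lemma mpoly_mult_nonzero:
  fixes f g :: "('n::finite, 'k::field_char_0) mpoly"
  assumes "f \<noteq> 0" "g \<noteq> 0"
  shows "f * g \<noteq> 0"
proof -
  obtain p q where "eval f p \<noteq> 0" "eval g q \<noteq> 0"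
    using eval_eq_0_imp_eq_0 assms by metis
  then obtain r where "eval f r \<noteq> 0" "eval g r \<noteq> 0"
    using common_nonzero by blast
  then have "eval (f * g) r \<noteq> 0" by simp
  then show ?thesis by (metis eval_zero)
qed

lemma reduce_mod_square:
  fixes g :: "('n::finite, 'k::field_char_0) mpoly"
  assumes "vars_in (insert i A) g" "vars_in A r"
  shows "\<exists>g0 g1 k. vars_in A g0 \<and> vars_in A g1 \<and> g = g0 + g1 * var i + k * (r - var i ^ 2)"
  using assms(1)
proof (induction rule: mpoly_induct)
  case (const c)
  have "const c = const c + const 0 * var i + 0 * (r - var i ^ 2)" by (simp add: const_def)
  then show ?case using vars_in_const by blast
next
  case (var_mult f j)
  then obtain g0 g1 k where g: "vars_in A g0" "vars_in A g1"
    "f = g0 + g1 * var i + k * (r - var i ^ 2)" by blast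
  show ?case
  proof (cases "j = i")
    case True
    have "var j * f = g1 * r + g0 * var i + (var i * k - g1) * (r - var i ^ 2)"
      unfolding True g(3) by (simp add: algebra_simps power2_eq_square)
    then show ?thesis using g assms(2) vars_in_mult by blast
  next
    case False
    then have "vars_in A (var j)" using var_mult.hyps by (intro vars_in_var) auto
    moreover have "var j * f = var j * g0 + (var j * g1) * var i + (var j * k) * (r - var i ^ 2)"
      unfolding g(3) by (simp add: algebra_simps)
    ultimately show ?thesis using g vars_in_mult by blast
  qed
next
  case (add f g)
  then obtain f0 f1 k g0 g1 l where f: "vars_in A f0" "vars_in A f1"
    "f = f0 + f1 * var i + k * (r - var i ^ 2)" and g: "vars_in A g0" "vars_in A g1"
    "g = g0 + g1 * var i + l * (r - var i ^ 2)" by blast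
  have "f + g = (f0 + g0) + (f1 + g1) * var i + (k + l) * (r - var i ^ 2)"
    unfolding f(3) g(3) by (simp add: algebra_simps)
  then show ?case using f g vars_in_add by blast
qed

text \<open>\<open>torsion_free V Q B A\<close>: a polynomial in the variables \<open>A\<close> lies in the ideal of \<open>Q\<close> as soon as
  its product with some nonzero polynomial in the variables \<open>B\<close> vanishes on \<open>V\<close>.\<close>

definition torsion_free ::
  "('n::finite \<Rightarrow> 'k::field_char_0) set \<Rightarrow> ('n, 'k) mpoly set \<Rightarrow> 'n set \<Rightarrow> 'n set \<Rightarrow> bool" where
  "torsion_free V Q B A \<longleftrightarrow> (\<forall>h g. vars_in B h \<longrightarrow> h \<noteq> 0 \<longrightarrow> vars_in A g \<longrightarrow>
     (\<forall>p\<in>V. eval h p * eval g p = 0) \<longrightarrow> g \<in> ideal_of Q)"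

lemma sum_diff_eq_0:
  fixes a b :: "'k::field_char_0"
  assumes "a + b = 0" "a - b = 0"
  shows "a = 0 \<and> b = 0"
proof -
  have "2 * a = (a + b) + (a - b)" by simp
  then show ?thesis using assms by simp
qed

text \<open>The property passes from the variables \<open>A\<close> to \<open>A\<close> and \<open>i\<close> if \<open>V\<close> satisfies an equation
  \<open>x\<^sub>i\<^sup>2 = r\<close> from \<open>Q\<close> and is stable under \<open>x\<^sub>i \<mapsto> - x\<^sub>i\<close>: modulo the equation \<open>g = g0 + g1 x\<^sub>i\<close>, and
  the values at a point and at its reflection show that \<open>h g0\<close> and \<open>h r g1\<close> vanish on \<open>V\<close>.\<close>

lemma torsion_free_adjoin_sqrt:
  assumes A: "torsion_free V Q B A" and Q: "finite Q" "r - var i ^ 2 \<in> Q"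
    and V: "\<And>p. p \<in> V \<Longrightarrow> eval r p = p i ^ 2"
    and flip: "\<And>p. p \<in> V \<Longrightarrow> p(i := - p i) \<in> V"
    and B: "B \<subseteq> A" "i \<notin> A" and r: "vars_in B r" "r \<noteq> 0"
  shows "torsion_free V Q B (insert i A)"
  unfolding torsion_free_def
proof (intro allI impI)
  fix h g
  assume h: "vars_in B h" "h \<noteq> 0" and g: "vars_in (insert i A) g"
    and 0: "\<forall>p\<in>V. eval h p * eval g p = 0"
  have rA: "vars_in A r" using r(1) B(1) by (rule vars_in_mono)
  obtain g0 g1 k where red: "vars_in A g0" "vars_in A g1"
    "g = g0 + g1 * var i + k * (r - var i ^ 2)"
    using reduce_mod_square[OF g rA] by blast
  have val: "eval h p * eval g0 p = 0" "eval (h * r) p * eval g1 p = 0" if p: "p \<in> V" for p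
  proof -
    let ?p' = "p(i := - p i)"
    have same: "eval f ?p' = eval f p" if "vars_in A f" for f
      using that by (rule eval_cong_vars) (use B(2) in auto)
    have hp: "eval h ?p' = eval h p" using vars_in_mono[OF h(1) B(1)] by (rule same)
    have "eval h p * (eval g0 p + eval g1 p * p i) = 0"
      using bspec[OF 0 p] V[OF p] by (simp add: red(3))
    moreover have "eval h p * (eval g0 p - eval g1 p * p i) = 0"
      using bspec[OF 0 flip[OF p]] V[OF flip[OF p]] same[OF red(1)] same[OF red(2)] hp
      by (simp add: red(3))
    ultimately have "eval h p = 0 \<or> eval g0 p = 0 \<and> eval g1 p * p i = 0"
      using sum_diff_eq_0[of "eval g0 p" "eval g1 p * p i"] by auto
    then have "eval h p * eval g0 p = 0" "eval h p * eval g1 p * p i = 0" by auto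
    then show "eval h p * eval g0 p = 0" by simp
    have "eval h p * eval g1 p * p i = 0" by fact
    then have "eval h p * eval g1 p * p i ^ 2 = 0" by (auto simp: power2_eq_square)
    then show "eval (h * r) p * eval g1 p = 0" using V[OF p] by auto
  qed
  have "g0 \<in> ideal_of Q" using A h red(1) val(1) unfolding torsion_free_def by blast
  moreover have "g1 \<in> ideal_of Q"
    using A red(2) val(2) vars_in_mult[OF h(1) r(1)] mpoly_mult_nonzero[OF h(2) r(2)]
    unfolding torsion_free_def by blast
  then have "g1 * var i \<in> ideal_of Q" using ideal_of_mult[of g1 Q "var i"] by (simp add: mult.commute)
  moreover have "k * (r - var i ^ 2) \<in> ideal_of Q"
    by (intro ideal_of_mult ideal_of_generator Q)
  ultimately show "g \<in> ideal_of Q" unfolding red(3) by (intro ideal_of_add)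
qed

section \<open>The vanishing ideal of the surface\<close>

lemma UNIV_coord2: "UNIV = {CA, CL, CT}"
  using coord2.exhaust by auto

lemma UNIV_coord5: "UNIV = {CX, CY, CU, CV, CW, CZ}"
  using coord5.exhaust by auto

lemma card_coord2: "CARD(coord2) = 3"
  by (simp add: UNIV_coord2)

lemma card_coord5: "CARD(coord5) = 6"
  by (simp add: UNIV_coord5)

lemma fun_eq_0_coord5: "p = (\<lambda>_. 0) \<longleftrightarrow>
    p CX = 0 \<and> p CY = 0 \<and> p CU = 0 \<and> p CV = 0 \<and> p CW = 0 \<and> p CZ = 0"
  by (metis (full_types) coord5.exhaust)

lemma surface_X_iff: "p \<in> surface_X \<longleftrightarrow> p \<noteq> (\<lambda>_. 0) \<and>
    (p CX + p CY) * p CZ = p CU ^ 2 \<and>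
    p CX * p CY + (p CX + p CY) * p CZ = p CV ^ 2 \<and>
    p CX * p CY - (p CX + p CY) * p CZ = p CW ^ 2"
  by (auto simp: surface_X_def quadrics_def zero_locus_def proj_space_def)

lemma finite_quadrics [simp]: "finite quadrics"
  by (simp add: quadrics_def)

lemma lift_to_surface_X:
  fixes x y z :: "'k::{field_char_0, alg_closed_field}"
  assumes "x \<noteq> 0"
  shows "\<exists>p\<in>surface_X. p CX = x \<and> p CY = y \<and> p CZ = z"
proof -
  obtain u v w where "u ^ 2 = (x + y) * z" "v ^ 2 = x * y + (x + y) * z"
    "w ^ 2 = x * y - (x + y) * z"
    using nth_root_exists[of 2] by (metis zero_less_numeral)
  with assms show ?thesis
    by (intro bexI[of _ "point5 x y u v w z"]) (auto simp: surface_X_iff point5_def fun_eq_0_coord5)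
qed

lemma torsion_free_surface_base:
  "torsion_free (surface_X :: (coord5 \<Rightarrow> 'k::{field_char_0, alg_closed_field}) set)
     quadrics {CX, CY, CZ} {CX, CY, CZ}"
  unfolding torsion_free_def
proof (intro allI impI)
  fix h g :: "(coord5, 'k) mpoly"
  assume h: "vars_in {CX, CY, CZ} h" "h \<noteq> 0" and g: "vars_in {CX, CY, CZ} g"
    and 0: "\<forall>p\<in>surface_X. eval h p * eval g p = 0"
  \<comment> \<open>the factor \<open>x\<close> excludes \<open>x = y = z = 0\<close>, over which the surface has no point\<close>
  have "eval (var CX * (h * g)) p = 0" for p
  proof (cases "p CX = 0")
    case False
    from lift_to_surface_X[OF this, of "p CY" "p CZ"]
    obtain q where q: "q \<in> surface_X" "q CX = p CX" "q CY = p CY" "q CZ = p CZ" by blast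
    have "eval (h * g) p = eval (h * g) q"
      using vars_in_mult[OF h(1) g] by (rule eval_cong_vars) (auto simp: q)
    then show ?thesis using 0 q(1) by simp
  qed simp
  then have "var CX * (h * g) = 0" by (rule eval_eq_0_imp_eq_0)
  moreover have "var CX \<noteq> (0 :: (coord5, 'k) mpoly)"
    using eval_var[of CX "\<lambda>_. 1 :: 'k"] by force
  ultimately have "g = 0" using mpoly_mult_nonzero h(2) by metis
  then show "g \<in> ideal_of quadrics" by (simp add: ideal_of_zero)
qed

lemma torsion_free_surface_X:
  "torsion_free (surface_X :: (coord5 \<Rightarrow> 'k::{field_char_0, alg_closed_field}) set)
     quadrics {CX, CY, CZ} UNIV"
proof -
  let ?V = "surface_X :: (coord5 \<Rightarrow> 'k) set" and ?B = "{CX, CY, CZ}"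
  let ?x = "var CX :: (coord5, 'k) mpoly" and ?y = "var CY :: (coord5, 'k) mpoly"
    and ?z = "var CZ :: (coord5, 'k) mpoly"
  note vi = vars_in_add vars_in_mult vars_in_diff vars_in_var
  have nz: "?x * ?y - (?x + ?y) * ?z \<noteq> 0" "?x * ?y + (?x + ?y) * ?z \<noteq> 0" "(?x + ?y) * ?z \<noteq> 0"
  proof -
    have *: "f \<noteq> 0" if "eval f (\<lambda>_. 1) \<noteq> 0" for f :: "(coord5, 'k) mpoly"
      using that by auto
    show "?x * ?y - (?x + ?y) * ?z \<noteq> 0" "?x * ?y + (?x + ?y) * ?z \<noteq> 0" "(?x + ?y) * ?z \<noteq> 0"
      by (rule *, simp)+
  qed
  have "torsion_free ?V quadrics ?B {CW, CX, CY, CZ}"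
    by (rule torsion_free_adjoin_sqrt[OF torsion_free_surface_base _ _ _ _ _ _ _ nz(1)])
       (auto simp: quadrics_def surface_X_iff fun_eq_0_coord5 intro!: vi)
  then have "torsion_free ?V quadrics ?B {CV, CW, CX, CY, CZ}"
    by (rule torsion_free_adjoin_sqrt[OF _ _ _ _ _ _ _ _ nz(2)])
       (auto simp: quadrics_def surface_X_iff fun_eq_0_coord5 intro!: vi)
  then have "torsion_free ?V quadrics ?B {CU, CV, CW, CX, CY, CZ}"
    by (rule torsion_free_adjoin_sqrt[OF _ _ _ _ _ _ _ _ nz(3)])
       (auto simp: quadrics_def surface_X_iff fun_eq_0_coord5 intro!: vi)
  moreover have "{CU, CV, CW, CX, CY, CZ} = UNIV" by (auto simp: UNIV_coord5)
  ultimately show ?thesis by simp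
qed

lemma ideal_of_quadrics_vanishes: "f \<in> ideal_of quadrics \<Longrightarrow> p \<in> surface_X \<Longrightarrow> eval f p = 0"
  by (auto simp: ideal_of_def surface_X_def zero_locus_def intro!: sum.neutral)

lemma vanishing_ideal_surface_X:
  "vanishing_ideal (surface_X :: (coord5 \<Rightarrow> 'k::{field_char_0, alg_closed_field}) set) =
     ideal_of quadrics"
proof
  show "vanishing_ideal (surface_X :: (coord5 \<Rightarrow> 'k) set) \<subseteq> ideal_of quadrics"
  proof
    fix f :: "(coord5, 'k) mpoly" assume "f \<in> vanishing_ideal surface_X"
    then show "f \<in> ideal_of quadrics"
      using torsion_free_surface_X[where 'k = 'k, unfolded torsion_free_def, rule_format,
          of "const 1" f] vars_in_const[of "{CX, CY, CZ}" 1]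
      by (auto simp: vanishing_ideal_def const_def)
  qed
qed (auto simp: vanishing_ideal_def ideal_of_quadrics_vanishes)

section \<open>The birational parametrization\<close>

text \<open>The common factor \<open>4 a\<^sup>2 l\<^sup>2 + 4 a\<^sup>4 + t\<^sup>4\<close>, which is \<open>4 a\<^sup>2 x\<close> in the affine chart \<open>t = 1\<close>.\<close>

definition x_numerator :: "(coord2, 'k::field_char_0) mpoly" where
  "x_numerator = const 4 * var CA ^ 2 * var CL ^ 2 + const 4 * var CA ^ 4 + var CT ^ 4"

text \<open>The formulas for \<open>(x : y : u : v : w : 1)\<close>, homogenized and cleared of the denominator
  \<open>16 a\<^sup>4 t\<^sup>2 l\<^sup>2\<close>.\<close>

definition surface_param :: "coord5 \<Rightarrow> (coord2, 'k::field_char_0) mpoly" where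
  "surface_param j = (case j of
      CX \<Rightarrow> const 4 * var CA ^ 2 * var CL ^ 2 * x_numerator
    | CY \<Rightarrow> (const 4 * var CA ^ 4 + var CT ^ 4) * x_numerator
    | CU \<Rightarrow> const 4 * var CA ^ 2 * var CT * var CL * x_numerator
    | CV \<Rightarrow> const 2 * var CA * var CL * (const 2 * var CA ^ 2 + var CT ^ 2) * x_numerator
    | CW \<Rightarrow> const 2 * var CA * var CL * (const 2 * var CA ^ 2 - var CT ^ 2) * x_numerator
    | CZ \<Rightarrow> const 16 * var CA ^ 4 * var CT ^ 2 * var CL ^ 2)"

text \<open>The inverse, in affine coordinates \<open>a = (v + w) / (2 u)\<close> and \<open>l = x / u\<close>.\<close>

definition surface_param_inv :: "coord2 \<Rightarrow> (coord5, 'k::field_char_0) mpoly" where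
  "surface_param_inv i = (case i of
      CA \<Rightarrow> var CV + var CW | CL \<Rightarrow> const 2 * var CX | CT \<Rightarrow> const 2 * var CU)"

lemma eval_x_numerator: "eval x_numerator p = 4 * p CA ^ 2 * p CL ^ 2 + 4 * p CA ^ 4 + p CT ^ 4"
  by (simp add: x_numerator_def)

lemma eval_surface_param:
  "eval_map surface_param p CX = 4 * p CA ^ 2 * p CL ^ 2 * eval x_numerator p"
  "eval_map surface_param p CY = (4 * p CA ^ 4 + p CT ^ 4) * eval x_numerator p"
  "eval_map surface_param p CU = 4 * p CA ^ 2 * p CT * p CL * eval x_numerator p"
  "eval_map surface_param p CV = 2 * p CA * p CL * (2 * p CA ^ 2 + p CT ^ 2) * eval x_numerator p"
  "eval_map surface_param p CW = 2 * p CA * p CL * (2 * p CA ^ 2 - p CT ^ 2) * eval x_numerator p"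
  "eval_map surface_param p CZ = 16 * p CA ^ 4 * p CT ^ 2 * p CL ^ 2"
  by (simp_all add: eval_map_def surface_param_def)

lemma eval_surface_param_inv:
  "eval_map surface_param_inv p CA = p CV + p CW"
  "eval_map surface_param_inv p CL = 2 * p CX"
  "eval_map surface_param_inv p CT = 2 * p CU"
  by (simp_all add: eval_map_def surface_param_inv_def)

lemma homogeneous_eq: "homogeneous d f \<Longrightarrow> d = e \<Longrightarrow> homogeneous e f"
  by simp

lemmas homogeneous_monomial_intros =
  homogeneous_mult homogeneous_power homogeneous_const homogeneous_var

lemma homogeneous_x_numerator: "homogeneous 4 x_numerator"
  unfolding x_numerator_def
  by (intro homogeneous_add; rule homogeneous_eq, (rule homogeneous_monomial_intros)+, simp)

lemma homogeneous_surface_param: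
  "homogeneous 8 (surface_param j :: (coord2, 'k::field_char_0) mpoly)"
proof -
  have 1: "homogeneous 4 (const 4 * var CA ^ 4 + var CT ^ 4 :: (coord2, 'k) mpoly)"
    by (intro homogeneous_add; rule homogeneous_eq, (rule homogeneous_monomial_intros)+, simp)
  have 2: "homogeneous 2 (const 2 * var CA ^ 2 + var CT ^ 2 :: (coord2, 'k) mpoly)"
    by (intro homogeneous_add; rule homogeneous_eq, (rule homogeneous_monomial_intros)+, simp)
  have 3: "homogeneous 2 (const 2 * var CA ^ 2 - var CT ^ 2 :: (coord2, 'k) mpoly)"
    by (intro homogeneous_diff; rule homogeneous_eq, (rule homogeneous_monomial_intros)+, simp)
  show ?thesis
    by (cases j; simp only: surface_param_def coord5.case; rule homogeneous_eq,
        (rule 1 2 3 homogeneous_x_numerator homogeneous_monomial_intros)+, simp)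
qed

lemmas rational_coeffs_intros =
  rational_coeffs_add rational_coeffs_diff rational_coeffs_mult rational_coeffs_power
  rational_coeffs_var rational_coeffs_const Rats_number_of

lemma rational_coeffs_surface_param: "rational_coeffs (surface_param j)"
  by (cases j; simp only: surface_param_def x_numerator_def coord5.case; intro rational_coeffs_intros)

lemma homogeneous_surface_param_inv: "homogeneous 1 (surface_param_inv i)"
proof (cases i)
  case CA
  then show ?thesis
    by (simp only: surface_param_inv_def coord2.case homogeneous_add homogeneous_var)
qed (simp only: surface_param_inv_def coord2.case; rule homogeneous_eq,
     (rule homogeneous_monomial_intros)+, simp)+

lemma rational_coeffs_surface_param_inv: "rational_coeffs (surface_param_inv i)"
  by (cases i; simp only: surface_param_inv_def coord2.case; intro rational_coeffs_intros)

lemma surface_param_in_surface_X: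
  assumes "eval_map surface_param p \<noteq> (\<lambda>_. 0)"
  shows "eval_map surface_param p \<in> surface_X"
proof -
  define n where "n = eval x_numerator p"
  have n: "4 * p CA ^ 2 * p CL ^ 2 + 4 * p CA ^ 4 + p CT ^ 4 = n"
    by (simp add: n_def eval_x_numerator)
  show ?thesis
    unfolding surface_X_iff eval_surface_param n_def[symmetric]
  proof (intro conjI assms)
    have s: "4 * p CA ^ 2 * p CL ^ 2 * n + (4 * p CA ^ 4 + p CT ^ 4) * n = n ^ 2"
      by (simp add: n[symmetric] algebra_simps power2_eq_square)
    show "(4 * p CA ^ 2 * p CL ^ 2 * n + (4 * p CA ^ 4 + p CT ^ 4) * n) * (16 * p CA ^ 4 * p CT ^ 2 * p CL ^ 2)
        = (4 * p CA ^ 2 * p CT * p CL * n) ^ 2"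
      unfolding s by (simp add: algebra_simps power_numeral_reduce)
    show "4 * p CA ^ 2 * p CL ^ 2 * n * ((4 * p CA ^ 4 + p CT ^ 4) * n) +
        (4 * p CA ^ 2 * p CL ^ 2 * n + (4 * p CA ^ 4 + p CT ^ 4) * n) * (16 * p CA ^ 4 * p CT ^ 2 * p CL ^ 2)
        = (2 * p CA * p CL * (2 * p CA ^ 2 + p CT ^ 2) * n) ^ 2"
      unfolding s by (simp add: algebra_simps power_numeral_reduce)
    show "4 * p CA ^ 2 * p CL ^ 2 * n * ((4 * p CA ^ 4 + p CT ^ 4) * n) -
        (4 * p CA ^ 2 * p CL ^ 2 * n + (4 * p CA ^ 4 + p CT ^ 4) * n) * (16 * p CA ^ 4 * p CT ^ 2 * p CL ^ 2)
        = (2 * p CA * p CL * (2 * p CA ^ 2 - p CT ^ 2) * n) ^ 2"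
      unfolding s by (simp add: algebra_simps power_numeral_reduce)
  qed
qed

lemma param_inv_param:
  "eval_map surface_param_inv (eval_map surface_param p) =
     (\<lambda>i. 8 * p CA ^ 2 * p CL * eval x_numerator p * p i)"
proof
  fix i
  show "eval_map surface_param_inv (eval_map surface_param p) i =
     8 * p CA ^ 2 * p CL * eval x_numerator p * p i"
    by (cases i) (simp_all add: eval_surface_param_inv eval_surface_param algebra_simps power_numeral_reduce)
qed

lemma param_param_inv:
  assumes "p \<in> surface_X"
  defines "q \<equiv> eval_map surface_param_inv p"
  shows "eval_map surface_param q =
    (\<lambda>i. 256 * (p CV + p CW) ^ 4 * p CX ^ 2 * (p CX + p CY) * p i)"
proof
  define x y u v w z
    where xyz: "x = p CX" "y = p CY" "u = p CU" "v = p CV" "w = p CW" "z = p CZ"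
  have eqs: "(x + y) * z = u ^ 2" "x * y + (x + y) * z = v ^ 2" "x * y - (x + y) * z = w ^ 2"
    using assms by (auto simp: surface_X_iff xyz)
  have q: "q CA = v + w" "q CL = 2 * x" "q CT = 2 * u"
    by (simp_all add: q_def eval_surface_param_inv xyz)
  have vw: "v ^ 2 + w ^ 2 = 2 * (x * y)" "v ^ 2 - w ^ 2 = 2 * u ^ 2"
    using eqs by (simp_all flip: eqs)
  have c: "4 * (v + w) ^ 4 + (2 * u) ^ 4 = 16 * (v + w) ^ 2 * (x * y)"
  proof -
    have "(2 * u) ^ 4 = 4 * (2 * u ^ 2) ^ 2" by (simp add: power_mult_distrib flip: power_mult)
    also have "4 * (v + w) ^ 4 + \<dots> = 8 * (v + w) ^ 2 * (v ^ 2 + w ^ 2)"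
      unfolding vw(2)[symmetric] by (simp add: algebra_simps power_numeral_reduce)
    finally show ?thesis by (simp add: vw(1))
  qed
  have n: "eval x_numerator q = 16 * (v + w) ^ 2 * x * (x + y)"
    unfolding eval_x_numerator q add.assoc c by (simp add: algebra_simps power_numeral_reduce)
  have u2: "(2 * u) ^ 2 = 2 * (v ^ 2 - w ^ 2)" unfolding vw by (simp add: power_mult_distrib)
  have cv: "2 * (v + w) ^ 2 + (2 * u) ^ 2 = 4 * (v + w) * v"
    and cw: "2 * (v + w) ^ 2 - (2 * u) ^ 2 = 4 * (v + w) * w"
    unfolding u2 by (simp_all add: algebra_simps power_numeral_reduce)
  define s where "s = v + w"
  fix i
  show "eval_map surface_param q i = 256 * (p CV + p CW) ^ 4 * p CX ^ 2 * (p CX + p CY) * p i"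
    by (cases i; simp only: eval_surface_param n q c cv cw flip: xyz; simp only: flip: s_def)
       (simp_all add: power_mult_distrib power_numeral_reduce eqs(1)[unfolded power2_eq_square, symmetric])
qed

text \<open>The parametrization is dominant: its image contains all points of the surface off the zeros
  of \<open>x (x + y)\<^sup>2 z\<close>, a polynomial in \<open>x, y, z\<close> that can be cancelled by \<open>torsion_free_surface_X\<close>.\<close>

lemma surface_param_dense:
  fixes f :: "(coord5, 'k::{field_char_0, alg_closed_field}) mpoly"
  assumes f: "homogeneous d f"
    and 0: "\<And>p. eval_map surface_param p \<noteq> (\<lambda>_. 0) \<Longrightarrow> eval f (eval_map surface_param p) = 0"
    and q: "q \<in> surface_X"
  shows "eval f q = 0"
proof -
  define h :: "(coord5, 'k) mpoly" where
    "h = var CX * (var CX + var CY) * ((var CX + var CY) * var CZ)"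
  have "vars_in {CX, CY, CZ} h"
    unfolding h_def by (intro vars_in_mult vars_in_add vars_in_var) auto
  moreover have "h \<noteq> 0"
  proof -
    have "eval h (\<lambda>_. 1) \<noteq> 0" by (simp add: h_def)
    then show ?thesis by auto
  qed
  moreover have "eval h p * eval f p = 0" if p: "p \<in> surface_X" for p
  proof (cases "eval h p = 0")
    case False
    define c where "c = 256 * (p CV + p CW) ^ 4 * p CX ^ 2 * (p CX + p CY)"
    have "(p CV + p CW) * (p CV - p CW) = 2 * ((p CX + p CY) * p CZ)"
    proof -
      have eqs: "p CX * p CY + (p CX + p CY) * p CZ = p CV ^ 2"
        "p CX * p CY - (p CX + p CY) * p CZ = p CW ^ 2"
        using p by (auto simp: surface_X_iff)
      have "(p CV + p CW) * (p CV - p CW) = p CV ^ 2 - p CW ^ 2"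
        by (simp add: algebra_simps power2_eq_square)
      then show ?thesis by (simp flip: eqs)
    qed
    then have "p CV + p CW \<noteq> 0" using False by (auto simp: h_def)
    then have c: "c \<noteq> 0" using False by (auto simp: c_def h_def)
    have im: "eval_map surface_param (eval_map surface_param_inv p) = (\<lambda>i. c * p i)"
      using param_param_inv[OF p] by (simp add: c_def)
    have "(\<lambda>i. c * p i) \<noteq> (\<lambda>_. 0)" using c p by (auto simp: surface_X_iff fun_eq_iff)
    then have "eval f (\<lambda>i. c * p i) = 0" using 0 im by metis
    then show ?thesis using c by (simp add: eval_scale[OF f])
  qed simp
  ultimately have "f \<in> ideal_of quadrics"
    using torsion_free_surface_X[where 'k = 'k] unfolding torsion_free_def by simp
  then show ?thesis using q by (rule ideal_of_quadrics_vanishes)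
qed

lemma param_at_ones:
  fixes p :: "coord5 \<Rightarrow> 'k::field_char_0"
  defines "p \<equiv> eval_map surface_param (\<lambda>_. 1)"
  shows "p CX = 36" "p CY = 45" "p CU = 36" "p CV = 54" "p CW = 18" "p CZ = 16"
  by (simp_all add: p_def eval_surface_param eval_x_numerator)

lemma birational_surface_param:
  "birational_map_over_Q proj_space
     (surface_X :: (coord5 \<Rightarrow> 'k::{field_char_0, alg_closed_field}) set) surface_param"
proof -
  let ?X = "surface_X :: (coord5 \<Rightarrow> 'k) set"
  define p0 :: "coord5 \<Rightarrow> 'k" where "p0 = eval_map surface_param (\<lambda>_. 1)"
  note p0 = param_at_ones[where 'k = 'k, folded p0_def]
  have ne0: "p0 \<noteq> (\<lambda>_. 0)" using p0(1) by auto
  then have X0: "p0 \<in> ?X" unfolding p0_def by (rule surface_param_in_surface_X)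
  have one: "(\<lambda>_. 1) \<in> (proj_space :: (coord2 \<Rightarrow> 'k) set)"
    by (simp add: proj_space_def fun_eq_iff)
  have inv_ne: "eval_map surface_param_inv p0 \<noteq> (\<lambda>_. 0)"
    using eval_surface_param_inv(2)[of p0] p0 by auto
  have back_ne: "eval_map surface_param (eval_map surface_param_inv p0) \<noteq> (\<lambda>_. 0)"
    using param_param_inv[OF X0] p0 by (auto dest: fun_cong[of _ _ CX])
  have "rational_map_over_Q (proj_space :: (coord2 \<Rightarrow> 'k) set) ?X surface_param"
    unfolding rational_map_over_Q_def
    using homogeneous_surface_param rational_coeffs_surface_param surface_param_in_surface_X one ne0
    unfolding p0_def by blast
  moreover have "rational_map_over_Q ?X proj_space surface_param_inv"
    unfolding rational_map_over_Q_def
    using homogeneous_surface_param_inv rational_coeffs_surface_param_inv X0 inv_ne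
    by (auto simp: proj_space_def)
  moreover have "left_inverse_map (proj_space :: (coord2 \<Rightarrow> 'k) set) surface_param surface_param_inv"
    unfolding left_inverse_map_def
  proof (intro conjI ballI impI)
    show "\<exists>p\<in>proj_space. eval_map surface_param p \<noteq> (\<lambda>_. 0 :: 'k) \<and>
        eval_map surface_param_inv (eval_map surface_param p) \<noteq> (\<lambda>_. 0)"
      using one ne0 inv_ne unfolding p0_def by blast
    fix p :: "coord2 \<Rightarrow> 'k"
    define c where "c = 8 * p CA ^ 2 * p CL * eval x_numerator p"
    assume "eval_map surface_param p \<noteq> (\<lambda>_. 0) \<and>
      eval_map surface_param_inv (eval_map surface_param p) \<noteq> (\<lambda>_. 0)"
    then have "(\<lambda>i. c * p i) \<noteq> (\<lambda>_. 0)" by (simp add: param_inv_param c_def)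
    then have "c \<noteq> 0" "(\<lambda>i. c * p i) \<noteq> (\<lambda>_. 0)" by auto
    then show "eval_map surface_param_inv (eval_map surface_param p) \<simeq> p"
      unfolding param_inv_param c_def[symmetric] proj_eq_def
      by (intro conjI exI[of _ "1 / c"]) auto
  qed
  moreover have "left_inverse_map ?X surface_param_inv surface_param"
    unfolding left_inverse_map_def
  proof (intro conjI ballI impI)
    show "\<exists>p\<in>?X. eval_map surface_param_inv p \<noteq> (\<lambda>_. 0) \<and>
        eval_map surface_param (eval_map surface_param_inv p) \<noteq> (\<lambda>_. 0)"
      using X0 inv_ne back_ne by blast
    fix p :: "coord5 \<Rightarrow> 'k"
    define c where "c = 256 * (p CV + p CW) ^ 4 * p CX ^ 2 * (p CX + p CY)"
    assume p: "p \<in> ?X" and "eval_map surface_param_inv p \<noteq> (\<lambda>_. 0) \<and>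
      eval_map surface_param (eval_map surface_param_inv p) \<noteq> (\<lambda>_. 0)"
    then have "(\<lambda>i. c * p i) \<noteq> (\<lambda>_. 0)" by (simp add: param_param_inv[OF p] c_def)
    then have "c \<noteq> 0" "(\<lambda>i. c * p i) \<noteq> (\<lambda>_. 0)" by auto
    then show "eval_map surface_param (eval_map surface_param_inv p) \<simeq> p"
      unfolding param_param_inv[OF p] c_def[symmetric] proj_eq_def
      by (intro conjI exI[of _ "1 / c"]) auto
  qed
  ultimately show ?thesis unfolding birational_map_over_Q_def by blast
qed

lemma surface_param_affine:
  fixes a l :: "'k::field_char_0"
  assumes "a \<noteq> 0" "l \<noteq> 0"
  defines "x \<equiv> l^2 + a^2 + 1 / (4 * a^2)"
  shows "eval_map surface_param (point2 a l 1) \<simeq>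
     point5 x ((a^2 + 1 / (4 * a^2)) * (x / l^2)) (x / l)
       ((a + 1 / (2 * a)) * (x / l)) ((a - 1 / (2 * a)) * (x / l)) 1"
proof -
  let ?p = "point2 a l 1" and ?c = "16 * a ^ 4 * l ^ 2"
  have c: "?c \<noteq> 0" using assms by simp
  have n: "eval x_numerator ?p = 4 * a ^ 2 * x"
    using assms(1) by (simp add: eval_x_numerator point2_def x_def field_simps)
  have "eval_map surface_param ?p CZ \<noteq> 0"
    unfolding eval_surface_param using c by (simp add: point2_def)
  moreover have "point5 x ((a^2 + 1 / (4 * a^2)) * (x / l^2)) (x / l)
       ((a + 1 / (2 * a)) * (x / l)) ((a - 1 / (2 * a)) * (x / l)) 1 =
     (\<lambda>i. 1 / ?c * eval_map surface_param ?p i)" (is "?q = _")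
  proof
    fix i
    show "?q i = 1 / ?c * eval_map surface_param ?p i"
      using assms(1,2)
      by (cases i; simp only: eval_surface_param n; simp add: point5_def point2_def field_simps power_numeral_reduce)
  qed
  ultimately show ?thesis
    unfolding proj_eq_def using c by (intro conjI exI[of _ "1 / ?c"]) auto
qed

section \<open>The dimension of the surface\<close>

lemma zariski_closed_zero_locus: "(\<And>f. f \<in> S \<Longrightarrow> \<exists>d. homogeneous d f) \<Longrightarrow> zariski_closed (zero_locus S)"
  by (auto simp: zariski_closed_def)

lemma quadrics_forms:
  fixes f :: "(coord5, 'k::field_char_0) mpoly"
  assumes "f \<in> quadrics"
  shows "rational_coeffs f \<and> homogeneous 2 f"
proof -
  have h: "homogeneous 2 (g * h)" if "homogeneous 1 g" "homogeneous 1 h" for g h :: "(coord5, 'k) mpoly"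
    using homogeneous_mult[OF that] by (simp only: one_add_one)
  have "homogeneous 2 f"
    using assms unfolding quadrics_def power2_eq_square
    by (auto intro!: homogeneous_add homogeneous_diff homogeneous_var h)
  moreover have "rational_coeffs f"
    using assms unfolding quadrics_def by (auto intro!: rational_coeffs_intros)
  ultimately show ?thesis by simp
qed

lemma card_quadrics: "card (quadrics :: (coord5, 'k::field_char_0) mpoly set) = 3"
proof -
  let ?q1 = "(var CX + var CY) * var CZ - var CU ^ 2 :: (coord5, 'k) mpoly"
  let ?q2 = "var CX * var CY + (var CX + var CY) * var CZ - var CV ^ 2 :: (coord5, 'k) mpoly"
  let ?q3 = "var CX * var CY - (var CX + var CY) * var CZ - var CW ^ 2 :: (coord5, 'k) mpoly"
  let ?e = "\<lambda>i j. if i = j then 1 else 0 :: 'k"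
  have "eval ?q1 (?e CU) \<noteq> eval ?q2 (?e CU)" "eval ?q1 (?e CU) \<noteq> eval ?q3 (?e CU)"
    "eval ?q2 (?e CV) \<noteq> eval ?q3 (?e CV)"
    by simp_all
  then have "?q1 \<noteq> ?q2" "?q1 \<noteq> ?q3" "?q2 \<noteq> ?q3" by metis+
  then show ?thesis unfolding quadrics_def by simp
qed

lemma zariski_closed_surface_X: "zariski_closed surface_X"
  unfolding surface_X_def using quadrics_forms by (intro zariski_closed_zero_locus) blast

lemma surface_X_nonempty: "(surface_X :: (coord5 \<Rightarrow> 'k::field_char_0) set) \<noteq> {}"
proof -
  have "eval_map surface_param (\<lambda>_. 1) \<noteq> (\<lambda>_. 0 :: 'k)"
    using param_at_ones(1)[where 'k = 'k] by auto
  then show ?thesis using surface_param_in_surface_X by blast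
qed

lemma irreducible_closed_surface_X:
  "irreducible_closed (surface_X :: (coord5 \<Rightarrow> 'k::{field_char_0, alg_closed_field}) set)"
  using zariski_closed_surface_X surface_X_nonempty surface_param_in_surface_X surface_param_dense
  by (rule irreducible_closed_parametrized[where F = surface_param]) auto

text \<open>The point \<open>(0 : 0 : 0 : 0 : 0 : 1)\<close> and, for \<open>r\<^sup>2 = -1\<close>, a line through it on the surface.\<close>

definition surface_point :: "(coord5 \<Rightarrow> 'k::field_char_0) set" where
  "surface_point = zero_locus {var CX, var CY, var CU, var CV, var CW}"

definition surface_line :: "'k \<Rightarrow> (coord5 \<Rightarrow> 'k::field_char_0) set" where
  "surface_line r = zero_locus
     {var CX + var CY, var CU, var CV - const r * var CX, var CW - const r * var CX}"

lemma surface_point_iff: "p \<in> surface_point \<longleftrightarrow> p \<noteq> (\<lambda>_. 0) \<and>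
    p CX = 0 \<and> p CY = 0 \<and> p CU = 0 \<and> p CV = 0 \<and> p CW = 0"
  by (auto simp: surface_point_def zero_locus_def proj_space_def)

lemma surface_line_iff: "p \<in> surface_line r \<longleftrightarrow> p \<noteq> (\<lambda>_. 0) \<and>
    p CY = - p CX \<and> p CU = 0 \<and> p CV = r * p CX \<and> p CW = r * p CX"
  by (auto simp: surface_line_def zero_locus_def proj_space_def add_eq_0_iff)

lemma irreducible_closed_surface_point:
  "irreducible_closed (surface_point :: (coord5 \<Rightarrow> 'k::field_char_0) set)"
proof (rule irreducible_closed_parametrized)
  define F :: "coord5 \<Rightarrow> (coord2, 'k) mpoly" where "F = (\<lambda>j. if j = CZ then 1 else 0)"
  have F: "eval_map F p = (\<lambda>j. if j = CZ then 1 else 0)" for p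
    by (auto simp: F_def eval_map_def)
  have pt: "(\<lambda>j. if j = CZ then 1 else 0) \<in> (surface_point :: (coord5 \<Rightarrow> 'k) set)"
    by (auto simp: surface_point_iff fun_eq_0_coord5)
  show "zariski_closed (surface_point :: (coord5 \<Rightarrow> 'k) set)"
    unfolding surface_point_def
    by (rule zariski_closed_zero_locus) (use homogeneous_var in blast)
  show "(surface_point :: (coord5 \<Rightarrow> 'k) set) \<noteq> {}" using pt by blast
  show "eval_map F p \<in> surface_point" for p using pt by (simp only: F)
  fix f :: "(coord5, 'k) mpoly" and d and q :: "coord5 \<Rightarrow> 'k"
  assume f: "homogeneous d f"
    and 0: "\<And>p. eval_map F p \<noteq> (\<lambda>_. 0) \<Longrightarrow> eval f (eval_map F p) = 0" and q: "q \<in> surface_point"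
  have "eval f (\<lambda>j. if j = CZ then 1 else 0) = 0"
    using 0 unfolding F by (metis zero_neq_one)
  moreover have "q = (\<lambda>j. q CZ * (if j = CZ then 1 else 0))"
    using q by (auto simp: surface_point_iff fun_eq_iff split: coord5.split) (metis coord5.exhaust)
  ultimately show "eval f q = 0" using eval_scale[OF f, of "q CZ"] by (metis mult_zero_right)
qed

lemma irreducible_closed_surface_line:
  fixes r :: "'k::field_char_0"
  shows "irreducible_closed (surface_line r)"
proof (rule irreducible_closed_parametrized)
  define F :: "coord5 \<Rightarrow> (coord2, 'k) mpoly" where
    "F = (\<lambda>j. case j of CX \<Rightarrow> var CA | CY \<Rightarrow> - var CA | CU \<Rightarrow> 0 | CV \<Rightarrow> const r * var CA
       | CW \<Rightarrow> const r * var CA | CZ \<Rightarrow> var CT)"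
  have F: "eval_map F p CX = p CA" "eval_map F p CY = - p CA" "eval_map F p CU = 0"
    "eval_map F p CV = r * p CA" "eval_map F p CW = r * p CA" "eval_map F p CZ = p CT" for p
    by (simp_all add: F_def eval_map_def)
  show "zariski_closed (surface_line r)"
    unfolding surface_line_def
  proof (rule zariski_closed_zero_locus)
    have "homogeneous 1 (const r * var CX)"
      using homogeneous_mult[OF homogeneous_const homogeneous_var, of r] by simp
    then have "homogeneous 1 f"
      if "f \<in> {var CX + var CY, var CU, var CV - const r * var CX, var CW - const r * var CX}" for f
      using that by (auto intro: homogeneous_add homogeneous_diff simp del: One_nat_def)
    then show "\<exists>d. homogeneous d f"
      if "f \<in> {var CX + var CY, var CU, var CV - const r * var CX, var CW - const r * var CX}" for f
      using that by blast
  qed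
  have "(\<lambda>j. if j = CZ then 1 else 0) \<in> surface_line r"
    by (auto simp: surface_line_iff fun_eq_0_coord5)
  then show "surface_line r \<noteq> {}" by blast
  show "eval_map F p \<in> surface_line r" if "eval_map F p \<noteq> (\<lambda>_. 0)" for p
    using that by (simp add: surface_line_iff F)
  fix f :: "(coord5, 'k) mpoly" and d and q :: "coord5 \<Rightarrow> 'k"
  assume 0: "\<And>p. eval_map F p \<noteq> (\<lambda>_. 0) \<Longrightarrow> eval f (eval_map F p) = 0" and q: "q \<in> surface_line r"
  have "eval_map F (point2 (q CX) 0 (q CZ)) = q"
  proof
    fix j show "eval_map F (point2 (q CX) 0 (q CZ)) j = q j"
      using q by (cases j) (simp_all add: F surface_line_iff point2_def)
  qed
  then show "eval f q = 0" using 0 q by (metis surface_line_iff)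
qed

lemma proj_dim_surface_X:
  "proj_dim (surface_X :: (coord5 \<Rightarrow> 'k::{field_char_0, alg_closed_field}) set) = 2"
proof (rule antisym)
  let ?X = "surface_X :: (coord5 \<Rightarrow> 'k) set"
  have "proj_dim ?X \<le> enat (CARD(coord2) - 1)"
    by (rule proj_dim_le_parametrized[where F = surface_param, OF homogeneous_surface_param])
       (blast intro: surface_param_dense)
  then show "proj_dim ?X \<le> 2" by (simp add: card_coord2 numeral_eq_enat)
  obtain r :: 'k where i: "r ^ 2 = - 1" using nth_root_exists[of 2] by (metis zero_less_numeral)
  define Z where "Z n = (if n = 0 then surface_point else if n = 1 then surface_line r else ?X)" for n :: nat
  have line_X: "surface_line r \<subseteq> ?X"
    using i by (auto simp: surface_line_iff surface_X_iff power_mult_distrib) (simp add: power2_eq_square)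
  moreover have "surface_point \<subseteq> surface_line r"
    by (auto simp: surface_line_iff surface_point_iff)
  moreover have "point5 1 (- 1) 0 r r 0 \<in> surface_line r - surface_point"
    by (auto simp: surface_line_iff surface_point_iff point5_def fun_eq_0_coord5)
  moreover have "eval_map surface_param (\<lambda>_. 1) \<in> ?X - surface_line r"
  proof -
    have "eval_map surface_param (\<lambda>_. 1) \<noteq> (\<lambda>_. 0 :: 'k)"
      using param_at_ones(1)[where 'k = 'k] by auto
    then have "eval_map surface_param (\<lambda>_. 1) \<in> ?X" by (rule surface_param_in_surface_X)
    moreover have "eval_map surface_param (\<lambda>_. 1) \<notin> surface_line r"
      using param_at_ones(3)[where 'k = 'k] by (auto simp: surface_line_iff)
    ultimately show ?thesis by blast
  qed
  ultimately have "surface_point \<subset> surface_line r" "surface_line r \<subset> ?X" by blast+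
  then have "(\<forall>n\<le>2. irreducible_closed (Z n) \<and> Z n \<subseteq> ?X) \<and> (\<forall>n<2. Z n \<subset> Z (Suc n))"
    using irreducible_closed_surface_point irreducible_closed_surface_line irreducible_closed_surface_X
    by (auto simp: Z_def less_2_cases_iff)
  then have "enat 2 \<le> proj_dim ?X"
    unfolding proj_dim_def by (intro SUP_upper CollectI exI[of _ Z])
  then show "2 \<le> proj_dim ?X" by (simp add: numeral_eq_enat)
qed

theorem mainTheorem2:
  shows "complete_intersection_over_Q (surface_X :: (coord5 \<Rightarrow> rat alg_closure) set) quadrics \<and>
    rational_surface_over_Q (surface_X :: (coord5 \<Rightarrow> rat alg_closure) set) \<and>
    (\<exists>F :: coord5 \<Rightarrow> (coord2, rat alg_closure) mpoly.
       birational_map_over_Q proj_space surface_X F \<and>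
       (\<forall>a l. a \<noteq> 0 \<and> l \<noteq> 0 \<longrightarrow>
          (let x = l^2 + a^2 + 1 / (4 * a^2);
               y = (a^2 + 1 / (4 * a^2)) * (x / l^2);
               u = x / l;
               v = (a + 1 / (2 * a)) * (x / l);
               w = (a - 1 / (2 * a)) * (x / l)
           in eval_map F (point2 a l 1) \<simeq> point5 x y u v w 1)))"
proof (intro conjI)
  let ?X = "surface_X :: (coord5 \<Rightarrow> rat alg_closure) set"
  have forms: "\<forall>f\<in>quadrics. rational_coeffs f \<and> (\<exists>d. homogeneous d f)"
    using quadrics_forms by blast
  have "proj_dim ?X + enat (card (quadrics :: (coord5, rat alg_closure) mpoly set)) + 1 = enat CARD(coord5)"
    by (simp add: proj_dim_surface_X card_quadrics card_coord5 numeral_eq_enat one_enat_def)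
  then show "complete_intersection_over_Q ?X quadrics"
    unfolding complete_intersection_over_Q_def
    using forms vanishing_ideal_surface_X by (simp add: surface_X_def ideal_of_def)
  have "variety_over_Q ?X"
    unfolding variety_over_Q_def
    using irreducible_closed_surface_X forms surface_X_def by blast
  then show "rational_surface_over_Q ?X"
    unfolding rational_surface_over_Q_def
    using proj_dim_surface_X birational_surface_param by blast
  show "\<exists>F :: coord5 \<Rightarrow> (coord2, rat alg_closure) mpoly.
       birational_map_over_Q proj_space ?X F \<and>
       (\<forall>a l. a \<noteq> 0 \<and> l \<noteq> 0 \<longrightarrow>
          (let x = l^2 + a^2 + 1 / (4 * a^2);
               y = (a^2 + 1 / (4 * a^2)) * (x / l^2);
               u = x / l;
               v = (a + 1 / (2 * a)) * (x / l);
               w = (a - 1 / (2 * a)) * (x / l)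
           in eval_map F (point2 a l 1) \<simeq> point5 x y u v w 1))"
    using birational_surface_param surface_param_affine
    by (intro exI[of _ surface_param]) (simp only: Let_def, blast)
qed

end
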